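(* Let $k,\ell\ge1$, $p=k+\ell$, $\alpha\in(0,1)$. Assume that $V_1=(X_1^\top\ R_1^\top)^\top\sim\mathcal N(m,\boldsymbol\Sigma)$ in $\mathbb{R}^p$, where $R_1=Y_1-\widehat Y_1$, that the smallest eigenvalue of $\boldsymbol\Sigma$ is positive, and set $\lambda=0$. Then $$\forall x\in\mathbb{R}^k,\quad\mathbb{P}(Y_1-\widehat Y_1\in\mathcal F_\alpha^\infty\mid X_1=x)=\mathbb{P}(Y_1-\widehat Y_1\in\mathcal F_\alpha^\infty)=1-\alpha.$$
   Context: $\widehat Y_1=\widehat f(X_1)$ for a fixed deterministic measurable $\widehat f:\mathbb{R}^k\to\mathbb{R}^\ell$. $\boldsymbol\Sigma=\begin{pmatrix}\boldsymbol\Sigma^{11}&\boldsymbol\Sigma^{12}\\ \boldsymbol\Sigma^{21}&\boldsymbol\Sigma^{22}\end{pmatrix}$ in blocks according to $p=k+\ell$; $\boldsymbol{\mathcal A}_\infty=\boldsymbol\Sigma^{22}-\boldsymbol\Sigma^{21}(\boldsymbol\Sigma^{11})^{-1}\boldsymbol\Sigma^{12}$; $X_{\mathrm c}=X_1-\mathbb{E}X_1$, $R_{\mathrm c}=R_1-\mathbb{E}R_1$; $T_{\mathrm c}=R_{\mathrm c}-\boldsymbol\Sigma^{21}(\boldsymbol\Sigma^{11})^{-1}X_{\mathrm c}$; $q_{1-\alpha}^{\mathcal F}=q_{1-\alpha}(T_{\mathrm c}^\top\boldsymbol{\mathcal A}_\infty^{-1}T_{\mathrm c})$ with $q_{1-\alpha}(\xi)=\inf\{r:\mathbb{P}(\xi>r)\le\alpha\}$;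 $Z_0^\infty=\boldsymbol\Sigma^{21}(\boldsymbol\Sigma^{11})^{-1}X_{\mathrm c}+\mathbb{E}[R_1]$ (a function of $X_1$). $\mathcal F_\alpha^\infty=\{z\in\mathbb{R}^\ell:(z-Z_0^\infty)^\top\boldsymbol{\mathcal A}_\infty^{-1}(z-Z_0^\infty)\le q_{1-\alpha}^{\mathcal F}\}$. Conditional probabilities given $X_1=x$ are with respect to the usual Gaussian regular conditional distribution of $R_1$ given $X_1=x$. *)

theory Defs
  imports "HOL-Probability.Probability"
begin

subsection \<open>Eigenvalues\<close>

definition eigenvalues :: "real^'n^'n \<Rightarrow> real set" where
  "eigenvalues A = {c. \<exists>v. v \<noteq> 0 \<and> A *v v = c *\<^sub>R v}"

text \<open>Meaningful for symmetric matrices, whose set of real eigenvalues is finite and nonempty.\<close>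

definition min_eigenvalue :: "real^'n^'n \<Rightarrow> real" where
  "min_eigenvalue A = Min (eigenvalues A)"

subsection \<open>Vectors and matrices in blocks\<close>

text \<open>A vector of dimension \<open>p = k + \<ell>\<close> is indexed by the sum type \<open>'k + 'l\<close>: the first \<open>k\<close>
  coordinates are those at \<open>Inl\<close>, the last \<open>\<ell>\<close> those at \<open>Inr\<close>.\<close>

definition stack :: "real^'k::finite \<Rightarrow> real^'l::finite \<Rightarrow> real^('k + 'l)" where
  "stack x y = (\<chi> i. case i of Inl a \<Rightarrow> x $ a | Inr b \<Rightarrow> y $ b)"

definition block11 :: "real^('k::finite + 'l::finite)^('k + 'l) \<Rightarrow> real^'k^'k" where
  "block11 S = (\<chi> i j. S $ Inl i $ Inl j)"

definition block12 :: "real^('k::finite + 'l::finite)^('k + 'l) \<Rightarrow> real^'l^'k" where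
  "block12 S = (\<chi> i j. S $ Inl i $ Inr j)"

definition block21 :: "real^('k::finite + 'l::finite)^('k + 'l) \<Rightarrow> real^'k^'l" where
  "block21 S = (\<chi> i j. S $ Inr i $ Inl j)"

definition block22 :: "real^('k::finite + 'l::finite)^('k + 'l) \<Rightarrow> real^'l^'l" where
  "block22 S = (\<chi> i j. S $ Inr i $ Inr j)"

definition regression_matrix :: "real^('k::finite + 'l::finite)^('k + 'l) \<Rightarrow> real^'k^'l" where
  "regression_matrix S = block21 S ** matrix_inv (block11 S)"

text \<open>The matrix \<open>\<A>\<^sub>\<infinity>\<close>, the Schur complement of the upper left block.\<close>

definition A_inf :: "real^('k::finite + 'l::finite)^('k + 'l) \<Rightarrow> real^'l^'l" where
  "A_inf S = block22 S - block21 S ** matrix_inv (block11 S) ** block12 S"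

subsection \<open>Gaussian laws, quantiles, regular conditional distributions\<close>

text \<open>The law \<open>N(m, S)\<close> for a symmetric positive definite \<open>S\<close>, through its Lebesgue density.
  Degenerate covariance matrices are not covered.\<close>

definition multivariate_normal :: "real^'n \<Rightarrow> real^'n^'n \<Rightarrow> (real^'n) measure" where
  "multivariate_normal m S =
     density lborel (\<lambda>v. ennreal (exp (- ((v - m) \<bullet> (matrix_inv S *v (v - m))) / 2)
                            / sqrt ((2 * pi) ^ CARD('n) * det S)))"

text \<open>\<open>upper_quantile M \<alpha> \<xi>\<close> is \<open>q\<^bsub>1-\<alpha>\<^esub>(\<xi>)\<close>.\<close>

definition upper_quantile :: "'a measure \<Rightarrow> real \<Rightarrow> ('a \<Rightarrow> real) \<Rightarrow> real" where
  "upper_quantile M \<alpha> \<xi> = Inf {r. measure M {\<omega> \<in> space M. \<xi> \<omega> > r} \<le> \<alpha>}"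

text \<open>\<open>K\<close> is a Markov kernel and \<open>P(X \<in> A, R \<in> B) = \<integral>\<^sub>A K(x)(B) dP\<^sub>X(x)\<close>.\<close>

definition regular_conditional_distribution ::
  "'a measure \<Rightarrow> ('a \<Rightarrow> real^'k) \<Rightarrow> ('a \<Rightarrow> real^'l) \<Rightarrow> (real^'k \<Rightarrow> (real^'l) measure) \<Rightarrow> bool" where
  "regular_conditional_distribution M X R K \<longleftrightarrow>
     K \<in> borel \<rightarrow>\<^sub>M prob_algebra borel \<and>
     (\<forall>A \<in> sets borel. \<forall>B \<in> sets borel.
        emeasure M {\<omega> \<in> space M. X \<omega> \<in> A \<and> R \<omega> \<in> B}
          = (\<integral>\<^sup>+x\<in>A. emeasure (K x) B \<partial>distr M borel X))"

subsection \<open>The limiting prediction ellipsoid\<close>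

text \<open>\<open>Z\<^sub>0\<^sup>\<infinity>\<close> as a function of the value \<open>x\<close> of \<open>X\<close>.\<close>

definition Z0_inf ::
  "'a measure \<Rightarrow> ('a \<Rightarrow> real^'k) \<Rightarrow> ('a \<Rightarrow> real^'l) \<Rightarrow> real^('k::finite + 'l::finite)^('k + 'l) \<Rightarrow> real^'k \<Rightarrow> real^'l"
  where
  "Z0_inf M X R S x =
     regression_matrix S *v (x - (\<integral>\<omega>. X \<omega> \<partial>M)) + (\<integral>\<omega>. R \<omega> \<partial>M)"

definition T_c ::
  "'a measure \<Rightarrow> ('a \<Rightarrow> real^'k) \<Rightarrow> ('a \<Rightarrow> real^'l) \<Rightarrow> real^('k::finite + 'l::finite)^('k + 'l) \<Rightarrow> 'a \<Rightarrow> real^'l"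
  where
  "T_c M X R S \<omega> =
     (R \<omega> - (\<integral>\<omega>'. R \<omega>' \<partial>M)) - regression_matrix S *v (X \<omega> - (\<integral>\<omega>'. X \<omega>' \<partial>M))"

definition q_F ::
  "'a measure \<Rightarrow> ('a \<Rightarrow> real^'k) \<Rightarrow> ('a \<Rightarrow> real^'l) \<Rightarrow> real^('k::finite + 'l::finite)^('k + 'l) \<Rightarrow> real \<Rightarrow> real" where
  "q_F M X R S \<alpha> =
     upper_quantile M \<alpha> (\<lambda>\<omega>. T_c M X R S \<omega> \<bullet> (matrix_inv (A_inf S) *v T_c M X R S \<omega>))"

text \<open>The random set \<open>\<F>\<^sub>\<alpha>\<^sup>\<infinity>\<close> depends on the outcome only through \<open>x = X \<omega>\<close>.\<close>

definition F_inf ::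
  "'a measure \<Rightarrow> ('a \<Rightarrow> real^'k) \<Rightarrow> ('a \<Rightarrow> real^'l) \<Rightarrow> real^('k::finite + 'l::finite)^('k + 'l) \<Rightarrow> real
    \<Rightarrow> real^'k \<Rightarrow> (real^'l) set" where
  "F_inf M X R S \<alpha> x =
     {z. (z - Z0_inf M X R S x) \<bullet> (matrix_inv (A_inf S) *v (z - Z0_inf M X R S x))
           \<le> q_F M X R S \<alpha>}"

text \<open>The usual Gaussian version of the conditional law of \<open>R\<close> given \<open>X = x\<close>: normal, with mean
  \<open>E[R] + \<Sigma>\<^sup>2\<^sup>1 (\<Sigma>\<^sup>1\<^sup>1)\<^sup>-\<^sup>1 (x - E[X]) = Z\<^sub>0\<^sup>\<infinity>(x)\<close> and covariance
  \<open>\<Sigma>\<^sup>2\<^sup>2 - \<Sigma>\<^sup>2\<^sup>1 (\<Sigma>\<^sup>1\<^sup>1)\<^sup>-\<^sup>1 \<Sigma>\<^sup>1\<^sup>2\<close>. Conditional probabilities given \<open>X = x\<close> are defined for every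
  \<open>x\<close> only after such a version is fixed.\<close>

definition gaussian_conditional ::
  "'a measure \<Rightarrow> ('a \<Rightarrow> real^'k) \<Rightarrow> ('a \<Rightarrow> real^'l) \<Rightarrow> real^('k::finite + 'l::finite)^('k + 'l)
    \<Rightarrow> real^'k \<Rightarrow> (real^'l) measure" where
  "gaussian_conditional M X R S x =
     multivariate_normal
       ((\<integral>\<omega>. R \<omega> \<partial>M) + block21 S ** matrix_inv (block11 S) *v (x - (\<integral>\<omega>. X \<omega> \<partial>M)))
       (block22 S - block21 S ** matrix_inv (block11 S) ** block12 S)"

end

theory Submission
  imports Defs
begin

text \<open>Everything rests on one identity: subtracting from \<open>R\<close> its regression on \<open>X\<close> leaves a
  residual \<open>T\<close> whose conditional law given \<open>X = x\<close> is \<open>N(0, A_inf \<Sigma>)\<close>, the same for every \<open>x\<close>.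
  In terms of \<open>T\<close> the random ellipsoid is a fixed sublevel set of the quadratic form \<open>\<xi>\<close> of the
  inverse of \<open>A_inf \<Sigma>\<close>. The coverage probability is therefore one number, \<open>P(\<xi>(T) \<le> q)\<close>, with or
  without conditioning, and it equals \<open>1 - \<alpha>\<close> because \<open>q\<close> is the upper quantile of \<open>\<xi>(T)\<close> and this
  variable has no atoms.

  The identity is the completion of the square \<open>quadratic_form_stack\<close>: the quadratic form of the
  inverse covariance at \<open>(a, b)\<close> is that of the inverse upper left block at \<open>a\<close> plus that of the
  inverse Schur complement at \<open>b\<close> minus its regression on \<open>a\<close>. With Tonelli in the two blocks it
  splits the joint density into a function of \<open>x\<close> alone times the normal density with mean
  \<open>regression_mean\<close> and covariance \<open>A_inf \<Sigma>\<close>, which is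
  \<open>multivariate_normal_disintegration\<close>. The factor depending on \<open>x\<close> is recognised as the density of the
  marginal by integrating over \<open>y\<close>, because the normal density with a positive definite covariance
  matrix has total mass one.

  That normalisation, and the fact that the ellipsoids \<open>\<xi> = r\<close> are null sets, follow from choosing
  coordinates in which a positive definite form becomes the Euclidean one
  (\<open>positive_definite_coordinates\<close>) and changing variables linearly in Lebesgue integrals
  (\<open>nn_integral_lborel_linear\<close>). The hypothesis on the least eigenvalue gives positive
  definiteness by minimising the quadratic form on the unit sphere. The ellipsoid is centred using
  the expectations of \<open>X\<close> and \<open>R\<close>, and these are the blocks of \<open>m\<close> by
  \<open>integral_multivariate_normal\<close>.\<close>

section \<open>Symmetric and positive definite matrices\<close>

definition positive_definite :: "real^'n^'n \<Rightarrow> bool" where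
  "positive_definite A \<longleftrightarrow> transpose A = A \<and> (\<forall>v. v \<noteq> 0 \<longrightarrow> 0 < v \<bullet> (A *v v))"

lemma inner_matrix_vector_transpose:
  fixes A :: "real^'m^'n"
  shows "x \<bullet> (A *v y) = (transpose A *v x) \<bullet> y"
  by (metis dot_lmul_matrix transpose_matrix_vector)

lemma symmetric_inner_swap:
  fixes A :: "real^'n^'n"
  assumes "transpose A = A"
  shows "x \<bullet> (A *v y) = y \<bullet> (A *v x)"
  by (metis assms inner_commute inner_matrix_vector_transpose)

lemma matrix_inv_mult:
  assumes "invertible A"
  shows "A ** matrix_inv A = mat 1" and "matrix_inv A ** A = mat 1"
  using someI_ex[OF assms[unfolded invertible_def]] by (auto simp: matrix_inv_def)

lemma matrix_inv_cancel:
  fixes A :: "real^'n^'n"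
  assumes "invertible A"
  shows "A *v (matrix_inv A *v x) = x" and "matrix_inv A *v (A *v x) = x"
  using matrix_inv_mult[OF assms] by (simp_all add: matrix_vector_mul_assoc)

text \<open>A minimiser \<open>v\<close> of the quadratic form on the unit sphere is an eigenvector: with \<open>c\<close> the
  minimum, the form \<open>h w = w \<bullet> A w - c (w \<bullet> w)\<close> is nonnegative and vanishes at \<open>v\<close>, so its derivative
  at \<open>v\<close> in the direction \<open>u = A v - c v\<close>, which is twice \<open>u \<bullet> u\<close>, must be zero.\<close>

lemma symmetric_least_eigenvalue:
  fixes A :: "real^'n^'n"
  assumes sym: "transpose A = A"
  obtains c where "c \<in> eigenvalues A" and "\<And>w. c * (w \<bullet> w) \<le> w \<bullet> (A *v w)"
proof -
  have "continuous_on (sphere 0 1) (\<lambda>v::real^'n. v \<bullet> (A *v v))"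
    by (intro continuous_intros linear_continuous_on_compose[OF continuous_on_id]) auto
  then obtain v :: "real^'n" where v: "norm v = 1"
      and least: "\<And>w. norm w = 1 \<Longrightarrow> v \<bullet> (A *v v) \<le> w \<bullet> (A *v w)"
    using continuous_attains_inf[of "sphere 0 1" "\<lambda>v. v \<bullet> (A *v v)"]
    by (auto simp: dist_norm)
  define c where "c = v \<bullet> (A *v v)"
  define h where "h w = w \<bullet> (A *v w) - c * (w \<bullet> w)" for w
  have h_nonneg: "0 \<le> h w" for w
  proof (cases "w = 0")
    case False
    then have "c \<le> (w /\<^sub>R norm w) \<bullet> (A *v (w /\<^sub>R norm w))"
      using least[of "w /\<^sub>R norm w"] by (simp add: c_def)
    also have "\<dots> = (w \<bullet> (A *v w)) / (w \<bullet> w)"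
      by (simp add: matrix_vector_mult_scaleR dot_square_norm power2_eq_square divide_inverse)
    finally show ?thesis using False by (simp add: h_def field_simps)
  qed (simp add: h_def)
  define u where "u = A *v v - c *\<^sub>R v"
  have vAu: "v \<bullet> (A *v u) = u \<bullet> (A *v v)"
    by (rule symmetric_inner_swap[OF sym])
  have vv: "v \<bullet> v = 1" using v by (simp add: norm_eq_1)
  have h_line: "h (v + t *\<^sub>R u) = 2 * t * (u \<bullet> u) + t\<^sup>2 * h u" for t
  proof -
    have "u \<bullet> (A *v v) = u \<bullet> u + c * (u \<bullet> v)"
      by (subst (3) u_def) (simp add: inner_diff_right)
    then show ?thesis
      by (simp add: h_def c_def[symmetric] vv vAu inner_commute[of v u] power2_eq_square algebra_simps)
  qed
  have "u = 0"
  proof (rule ccontr)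
    assume "u \<noteq> 0"
    then have d: "0 < u \<bullet> u" by simp
    \<comment> \<open>A negative step so short that the linear term of \<open>h_line\<close> dominates the quadratic one; the
      \<open>+ 1\<close> covers the case \<open>h u = 0\<close>.\<close>
    define t where "t = - (u \<bullet> u) / (h u + 1)"
    have hp: "0 < h u + 1" using h_nonneg[of u] by simp
    have "t < 0" using d hp by (simp add: t_def field_simps)
    moreover have "0 < 2 * (u \<bullet> u) + t * h u"
    proof -
      have "t * h u = - (u \<bullet> u) * (h u / (h u + 1))" by (simp add: t_def)
      moreover have "(u \<bullet> u) * (h u / (h u + 1)) \<le> u \<bullet> u"
        using d hp by (intro mult_left_le) auto
      ultimately show ?thesis using d by linarith
    qed
    ultimately have "t * (2 * (u \<bullet> u) + t * h u) < 0" by (rule mult_neg_pos)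
    then have "h (v + t *\<^sub>R u) < 0" unfolding h_line by (simp add: power2_eq_square algebra_simps)
    with h_nonneg show False by (simp add: not_less[symmetric])
  qed
  then have "c \<in> eigenvalues A"
    using v by (auto simp: eigenvalues_def u_def intro!: exI[of _ v])
  with h_nonneg that show thesis by (auto simp: h_def)
qed

text \<open>Eigenvectors for distinct eigenvalues are orthogonal, hence independent. Finiteness is what makes
  \<open>Min\<close> in the definition of \<open>min_eigenvalue\<close> an actual lower bound.\<close>

lemma finite_eigenvalues_symmetric:
  fixes A :: "real^'n^'n"
  assumes sym: "transpose A = A"
  shows "finite (eigenvalues A)"
proof -
  obtain v where v: "\<And>c. c \<in> eigenvalues A \<Longrightarrow> v c \<noteq> 0 \<and> A *v v c = c *\<^sub>R v c"
    using bchoice[of "eigenvalues A" "\<lambda>c v. v \<noteq> 0 \<and> A *v v = c *\<^sub>R v"]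
    by (auto simp: eigenvalues_def)
  have orth: "v c \<bullet> v d = 0" if "c \<in> eigenvalues A" "d \<in> eigenvalues A" "c \<noteq> d" for c d
  proof -
    have "v c \<bullet> (A *v v d) = (A *v v c) \<bullet> v d"
      by (simp add: inner_matrix_vector_transpose sym)
    then have "(c - d) * (v c \<bullet> v d) = 0" using that v by (simp add: algebra_simps)
    with that show ?thesis by simp
  qed
  have inj: "inj_on v (eigenvalues A)"
    by (rule inj_onI) (metis inner_eq_zero_iff orth v)
  have "independent (v ` eigenvalues A)"
    by (rule pairwise_orthogonal_independent)
       (auto simp: pairwise_def orthogonal_def orth dest: v, metis orth)
  then show ?thesis
    using inj finite_imageD independent_imp_finite by blast
qed

lemma positive_definite_if_min_eigenvalue_pos:
  fixes A :: "real^'n^'n"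
  assumes sym: "transpose A = A" and pos: "min_eigenvalue A > 0"
  shows "positive_definite A"
proof -
  obtain c where c: "c \<in> eigenvalues A" and le: "\<And>w. c * (w \<bullet> w) \<le> w \<bullet> (A *v w)"
    using symmetric_least_eigenvalue[OF sym] by blast
  have "0 < c"
    using pos Min_le[OF finite_eigenvalues_symmetric[OF sym] c] by (simp add: min_eigenvalue_def)
  then have "0 < w \<bullet> (A *v w)" if "w \<noteq> 0" for w
    using le[of w] that by (smt (verit) inner_gt_zero_iff mult_pos_pos)
  with sym show ?thesis by (simp add: positive_definite_def)
qed

lemma positive_definite_coercive:
  fixes A :: "real^'n^'n"
  assumes pd: "positive_definite A"
  obtains c where "0 < c" and "\<And>w. c * (w \<bullet> w) \<le> w \<bullet> (A *v w)"
proof -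
  from pd have sym: "transpose A = A" by (simp add: positive_definite_def)
  obtain c where c: "c \<in> eigenvalues A" and le: "\<And>w. c * (w \<bullet> w) \<le> w \<bullet> (A *v w)"
    using symmetric_least_eigenvalue[OF sym] by blast
  from c obtain v where "v \<noteq> 0" "A *v v = c *\<^sub>R v" by (auto simp: eigenvalues_def)
  with pd have "0 < c * (v \<bullet> v)" unfolding positive_definite_def by fastforce
  then have "0 < c" using zero_less_mult_pos2[of c "v \<bullet> v"] \<open>v \<noteq> 0\<close> by simp
  with le that show thesis by blast
qed

lemma positive_definite_invertible:
  fixes A :: "real^'n^'n"
  assumes "positive_definite A"
  shows "invertible A"
proof -
  have "x = 0" if "A *v x = 0" for x
    using assms that unfolding positive_definite_def by (metis inner_zero_right less_irrefl)
  then show ?thesis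
    using matrix_left_invertible_ker[of A] by (auto simp: invertible_left_inverse)
qed

lemma positive_definite_matrix_inv:
  fixes A :: "real^'n^'n"
  assumes pd: "positive_definite A"
  shows "positive_definite (matrix_inv A)"
  unfolding positive_definite_def
proof (intro conjI allI impI)
  note inv = positive_definite_invertible[OF pd]
  have sym: "transpose A = A" using pd by (simp add: positive_definite_def)
  have "A ** transpose (matrix_inv A) = mat 1"
    using arg_cong[OF matrix_inv_mult(2)[OF inv], of transpose]
    by (simp add: matrix_transpose_mul sym)
  then show "transpose (matrix_inv A) = matrix_inv A"
    by (metis inv matrix_inv_mult(2) matrix_mul_assoc matrix_mul_lid matrix_mul_rid)
  fix v :: "real^'n" assume "v \<noteq> 0"
  then have "matrix_inv A *v v \<noteq> 0"
    by (metis inv matrix_inv_cancel(1) matrix_vector_mult_0_right)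
  then show "0 < v \<bullet> (matrix_inv A *v v)"
    using pd unfolding positive_definite_def by (metis inner_commute inv matrix_inv_cancel(1))
qed

text \<open>Gram-Schmidt for the inner product \<open>x \<bullet> C y\<close>. A \<open>C\<close>-orthonormal family \<open>F\<close> with fewer than \<open>n\<close>
  members can be enlarged, because the vectors \<open>C f\<close> do not span the space and a vector orthogonal
  to all of them is \<open>C\<close>-orthogonal to \<open>F\<close>. A family of \<open>n\<close> members gives the columns of \<open>P\<close>.\<close>

lemma positive_definite_whitening:
  fixes C :: "real^'n^'n"
  assumes pd: "positive_definite C"
  obtains P :: "real^'n^'n" where "transpose P ** C ** P = mat 1"
proof -
  have sym: "x \<bullet> (C *v y) = y \<bullet> (C *v x)" for x y
    using pd by (intro symmetric_inner_swap) (simp add: positive_definite_def)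
  have "\<exists>F. finite F \<and> card F = k \<and> (\<forall>f\<in>F. \<forall>g\<in>F. f \<bullet> (C *v g) = (if f = g then 1 else 0))"
    if "k \<le> CARD('n)" for k
    using that
  proof (induction k)
    case 0
    show ?case by (intro exI[of _ "{}"]) auto
  next
    case (Suc k)
    then obtain F where F: "finite F" "card F = k"
      and orth: "\<forall>f\<in>F. \<forall>g\<in>F. f \<bullet> (C *v g) = (if f = g then 1 else 0)" by auto
    have "dim ((*v) C ` F) \<le> card ((*v) C ` F)" by (rule dim_le_card') (simp add: F)
    also have "\<dots> < DIM(real^'n)" using card_image_le[OF F(1), of "(*v) C"] F Suc.prems by simp
    finally obtain x where "x \<noteq> 0" and x: "\<And>y. y \<in> span ((*v) C ` F) \<Longrightarrow> orthogonal x y"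
      using orthogonal_to_subspace_exists by blast
    have xF: "x \<bullet> (C *v f) = 0" if "f \<in> F" for f
      using x[of "C *v f"] that by (auto simp: orthogonal_def intro: span_base)
    have q: "0 < x \<bullet> (C *v x)" using pd \<open>x \<noteq> 0\<close> by (simp add: positive_definite_def)
    define z where "z = x /\<^sub>R sqrt (x \<bullet> (C *v x))"
    have zz: "z \<bullet> (C *v z) = 1"
      using q by (simp add: z_def matrix_vector_mult_scaleR field_simps flip: power2_eq_square)
    have zF: "z \<bullet> (C *v f) = 0" if "f \<in> F" for f
      using xF[OF that] by (simp add: z_def)
    have Fz: "f \<bullet> (C *v z) = 0" if "f \<in> F" for f
      using zF[OF that] sym[of f z] by simp
    have "z \<notin> F" using zF zz by force
    then have "finite (insert z F) \<and> card (insert z F) = Suc k \<and>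
        (\<forall>f\<in>insert z F. \<forall>g\<in>insert z F. f \<bullet> (C *v g) = (if f = g then 1 else 0))"
      using F orth zz zF Fz by auto
    then show ?case by blast
  qed
  from this[OF le_refl] obtain F where F: "finite F" "card F = CARD('n)"
    and orth: "\<forall>f\<in>F. \<forall>g\<in>F. f \<bullet> (C *v g) = (if f = g then 1 else 0)" by blast
  obtain e where e: "bij_betw e (UNIV::'n set) F"
    using finite_same_card_bij[of "UNIV::'n set" F] F by auto
  define P :: "real^'n^'n" where "P = (\<chi> i j. e j $ i)"
  have P: "P *v axis j 1 = e j" for j
    by (simp add: matrix_vector_mult_basis column_def P_def vec_eq_iff)
  have "(transpose P ** C ** P) $ i $ j = mat 1 $ i $ j" for i j
  proof -
    have "(transpose P ** C ** P) $ i $ j = axis i 1 \<bullet> ((transpose P ** C ** P) *v axis j 1)"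
      by (simp add: matrix_vector_mult_basis column_def inner_axis')
    also have "(transpose P ** C ** P) *v axis j 1 = transpose P *v (C *v e j)"
      by (simp only: matrix_vector_mul_assoc[symmetric] P)
    also have "axis i 1 \<bullet> (transpose P *v (C *v e j)) = e i \<bullet> (C *v e j)"
      by (simp only: inner_matrix_vector_transpose[of _ "transpose P"] transpose_transpose P)
    also have "\<dots> = mat 1 $ i $ j"
      using orth bij_betwE[OF e] bij_betw_imp_inj_on[OF e] by (auto simp: mat_def inj_on_eq_iff)
    finally show ?thesis .
  qed
  then have "transpose P ** C ** P = mat 1" by (simp add: vec_eq_iff)
  with that show thesis .
qed

section \<open>Lebesgue measure under linear maps\<close>

lemma nn_integral_lborel_translate:
  fixes f :: "'a::euclidean_space \<Rightarrow> ennreal"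
  assumes [measurable]: "f \<in> borel_measurable borel"
  shows "(\<integral>\<^sup>+x. f (x + a) \<partial>lborel) = (\<integral>\<^sup>+x. f x \<partial>lborel)"
proof -
  have "(\<integral>\<^sup>+x. f x \<partial>lborel) = (\<integral>\<^sup>+x. f x \<partial>distr lborel borel ((+) a))"
    by (simp only: lborel_distr_plus)
  then show ?thesis by (simp add: nn_integral_distr add.commute)
qed

text \<open>Tonelli in the coordinate \<open>e\<close>: on each line parallel to \<open>e\<close> the map is a translation by the
  constant value of \<open>g\<close> there.\<close>

lemma nn_integral_lborel_shear:
  fixes e :: "'a::euclidean_space" and f :: "'a \<Rightarrow> ennreal" and g :: "'a \<Rightarrow> real"
  assumes e: "e \<in> Basis" and [measurable]: "f \<in> borel_measurable borel" "g \<in> borel_measurable borel"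
    and inv: "\<And>x t. g (x + t *\<^sub>R e) = g x"
  shows "(\<integral>\<^sup>+x. f (x + g x *\<^sub>R e) \<partial>lborel) = (\<integral>\<^sup>+x. f x \<partial>lborel)"
proof -
  interpret product_sigma_finite "\<lambda>_::'a. lborel :: real measure" ..
  define r where "r x = (\<Sum>b\<in>Basis - {e}. x b *\<^sub>R b)" for x :: "'a \<Rightarrow> real"
  have fubini: "(\<integral>\<^sup>+x. h x \<partial>lborel)
      = (\<integral>\<^sup>+x. (\<integral>\<^sup>+t. h (r x + t *\<^sub>R e) \<partial>lborel) \<partial>Pi\<^sub>M (Basis - {e}) (\<lambda>_. lborel))"
    if [measurable]: "h \<in> borel_measurable borel" for h :: "'a \<Rightarrow> ennreal"
  proof -
    have B: "insert e (Basis - {e}) = (Basis :: 'a set)" using e by auto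
    have split: "(\<Sum>b\<in>Basis. (x(e := t)) b *\<^sub>R b) = r x + t *\<^sub>R e" for x t
    proof -
      have "(\<Sum>b\<in>Basis. (x(e := t)) b *\<^sub>R b) = t *\<^sub>R e + (\<Sum>b\<in>Basis - {e}. (x(e := t)) b *\<^sub>R b)"
        using e by (simp add: sum.remove)
      also have "(\<Sum>b\<in>Basis - {e}. (x(e := t)) b *\<^sub>R b) = r x"
        unfolding r_def by (rule sum.cong) auto
      finally show ?thesis by simp
    qed
    have "(\<integral>\<^sup>+x. h x \<partial>lborel)
        = (\<integral>\<^sup>+x. h (\<Sum>b\<in>Basis. x b *\<^sub>R b) \<partial>Pi\<^sub>M (insert e (Basis - {e})) (\<lambda>_. lborel))"
      unfolding B by (subst lborel_eq) (simp add: nn_integral_distr)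
    also have "\<dots> = (\<integral>\<^sup>+x. (\<integral>\<^sup>+t. h (\<Sum>b\<in>Basis. (x(e := t)) b *\<^sub>R b) \<partial>lborel) \<partial>Pi\<^sub>M (Basis - {e}) (\<lambda>_. lborel))"
      by (rule product_nn_integral_insert) (simp_all add: insert_absorb[OF e])
    finally show ?thesis by (simp only: split)
  qed
  have "(\<integral>\<^sup>+x. f (x + g x *\<^sub>R e) \<partial>lborel)
      = (\<integral>\<^sup>+x. (\<integral>\<^sup>+t. f (r x + (t + g (r x)) *\<^sub>R e) \<partial>lborel) \<partial>Pi\<^sub>M (Basis - {e}) (\<lambda>_. lborel))"
    by (subst fubini) (simp_all add: inv algebra_simps)
  also have "\<dots> = (\<integral>\<^sup>+x. (\<integral>\<^sup>+t. f (r x + t *\<^sub>R e) \<partial>lborel) \<partial>Pi\<^sub>M (Basis - {e}) (\<lambda>_. lborel))"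
    by (intro nn_integral_cong nn_integral_lborel_translate[of "\<lambda>t. f (r _ + t *\<^sub>R e)"]) simp
  also have "\<dots> = (\<integral>\<^sup>+x. f x \<partial>lborel)"
    by (rule fubini[symmetric]) simp
  finally show ?thesis .
qed

lemma bij_betw_axis_Basis: "bij_betw (\<lambda>i. axis i 1) UNIV (Basis :: (real^'n) set)"
  by (auto simp: bij_betw_def inj_on_def axis_eq_axis Basis_vec_def)

lemmas sum_Basis_cart = sum.reindex_bij_betw[OF bij_betw_axis_Basis, symmetric]
lemmas prod_Basis_cart = prod.reindex_bij_betw[OF bij_betw_axis_Basis, symmetric]

lemma emeasure_lborel_box_cart:
  fixes l u :: "real^'n"
  assumes "\<And>i. l $ i \<le> u $ i"
  shows "emeasure lborel (box l u) = ennreal (\<Prod>i\<in>UNIV. u $ i - l $ i)"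
proof -
  have "emeasure lborel (box l u) = (\<Prod>b\<in>Basis. (u - l) \<bullet> b)"
    using assms by (intro emeasure_lborel_box) (auto simp: Basis_vec_def inner_axis)
  then show ?thesis by (simp add: prod_Basis_cart inner_axis)
qed

lemma nn_integral_lborel_permute:
  fixes f :: "real^'n \<Rightarrow> ennreal"
  assumes p: "p permutes (UNIV :: 'n set)" and [measurable]: "f \<in> borel_measurable borel"
  shows "(\<integral>\<^sup>+x. f (\<chi> i. x $ p i) \<partial>lborel) = (\<integral>\<^sup>+x. f x \<partial>lborel)"
proof -
  let ?T = "\<lambda>x::real^'n. \<chi> i. x $ p i"
  have [measurable]: "?T \<in> borel \<rightarrow>\<^sub>M borel"
    by (intro borel_measurable_continuous_onI continuous_intros)
  have "lborel = distr lborel borel ?T"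
  proof (rule lborel_eqI)
    fix l u :: "real^'n" assume le: "\<And>b. b \<in> Basis \<Longrightarrow> l \<bullet> b \<le> u \<bullet> b"
    have le': "l $ i \<le> u $ i" for i using le[of "axis i 1"] by (simp add: inner_axis)
    define q where "q = inv p"
    have q: "q permutes UNIV" "p (q i) = i" "q (p i) = i" for i
      using permutes_inv[OF p] permutes_inverses[OF p] by (simp_all add: q_def)
    have bq: "bij q" using q(1) by (rule permutes_bij)
    have pre: "?T -` box l u = box (\<chi> i. l $ q i) (\<chi> i. u $ q i)"
      by (auto simp: mem_box_cart) (metis q(2,3))+
    have "emeasure (distr lborel borel ?T) (box l u) = emeasure lborel (box (\<chi> i. l $ q i) (\<chi> i. u $ q i))"
      by (simp add: emeasure_distr pre)
    also have "\<dots> = (\<Prod>i\<in>UNIV. u $ q i - l $ q i)"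
      using le' by (simp add: emeasure_lborel_box_cart)
    also have "(\<Prod>i\<in>UNIV. u $ q i - l $ q i) = (\<Prod>i\<in>UNIV. u $ i - l $ i)"
      using bq by (rule prod.reindex_bij_betw)
    also have "\<dots> = (\<Prod>b\<in>Basis. (u - l) \<bullet> b)"
      by (simp add: prod_Basis_cart inner_axis)
    finally show "emeasure (distr lborel borel ?T) (box l u) = (\<Prod>b\<in>Basis. (u - l) \<bullet> b)" .
  qed simp
  then have "(\<integral>\<^sup>+x. f x \<partial>lborel) = (\<integral>\<^sup>+x. f x \<partial>distr lborel borel ?T)" by simp
  also have "\<dots> = (\<integral>\<^sup>+x. f (?T x) \<partial>lborel)" by (simp add: nn_integral_distr)
  finally show ?thesis by simp
qed

lemma borel_measurable_matrix_vector_mult [measurable]: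
  fixes A :: "real^'m^'n"
  shows "(*v) A \<in> borel_measurable borel"
  by (intro borel_measurable_continuous_onI linear_continuous_on) auto

lemma nn_integral_lborel_diagonal:
  fixes f :: "real^'n \<Rightarrow> ennreal" and A :: "real^'n^'n"
  assumes diag: "\<And>i j. i \<noteq> j \<Longrightarrow> A $ i $ j = 0" and nz: "det A \<noteq> 0"
    and [measurable]: "f \<in> borel_measurable borel"
  shows "(\<integral>\<^sup>+x. f x \<partial>lborel) = ennreal \<bar>det A\<bar> * (\<integral>\<^sup>+x. f (A *v x) \<partial>lborel)"
proof -
  have det: "det A = (\<Prod>i\<in>UNIV. A $ i $ i)" by (rule det_diagonal) (rule diag)
  define c where "c b = b \<bullet> (A *v b)" for b :: "real^'n"
  have c_axis: "c (axis i 1) = A $ i $ i" for i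
    by (simp add: c_def matrix_vector_mult_basis column_def inner_axis')
  have c_nz: "c b \<noteq> 0" if "b \<in> Basis" for b
    using nz that by (auto simp: Basis_vec_def c_axis det)
  have eq: "0 + (\<Sum>j\<in>Basis. (c j * (x \<bullet> j)) *\<^sub>R j) = A *v x" for x
  proof (rule vec_eq_iff[THEN iffD2], intro allI)
    fix i
    have "(A *v x) $ i = A $ i $ i * x $ i"
      using diag by (simp add: matrix_vector_mult_def sum.remove[of _ i])
    then show "(0 + (\<Sum>j\<in>Basis. (c j * (x \<bullet> j)) *\<^sub>R j)) $ i = (A *v x) $ i"
      by (simp add: sum_Basis_cart inner_axis c_axis) (simp add: axis_def if_distrib cong: if_cong)
  qed
  have "(lborel :: (real^'n) measure) = density (distr lborel borel ((*v) A)) (\<lambda>_. ennreal (\<Prod>j\<in>Basis. \<bar>c j\<bar>))"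
    using lborel_affine_euclidean[of c 0] c_nz unfolding eq by simp
  also have "(\<Prod>j\<in>Basis. \<bar>c j\<bar>) = \<bar>det A\<bar>"
    by (simp add: prod_Basis_cart c_axis det abs_prod)
  finally have "(\<integral>\<^sup>+x. f x \<partial>lborel) = (\<integral>\<^sup>+x. f x \<partial>density (distr lborel borel ((*v) A)) (\<lambda>_. ennreal \<bar>det A\<bar>))"
    by simp
  then show ?thesis by (simp add: nn_integral_density nn_integral_cmult nn_integral_distr)
qed

text \<open>The formula is multiplicative in \<open>A\<close>, so it is enough to have it for the elementary matrices:
  diagonal ones, transpositions of coordinates, and shears adding one coordinate to another.\<close>

theorem nn_integral_lborel_linear:
  fixes A :: "real^'n^'n"
  assumes "det A \<noteq> 0" and "f \<in> borel_measurable borel"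
  shows "(\<integral>\<^sup>+x. f x \<partial>lborel) = ennreal \<bar>det A\<bar> * (\<integral>\<^sup>+x. f (A *v x) \<partial>lborel)"
proof -
  have "det A \<noteq> 0 \<longrightarrow> (\<forall>f\<in>borel_measurable borel.
      (\<integral>\<^sup>+x. f x \<partial>lborel) = ennreal \<bar>det A\<bar> * (\<integral>\<^sup>+x. f (A *v x) \<partial>lborel))" (is "?P A")
  proof (induction A rule: induct_matrix_elementary_alt)
    case (1 A B)
    show ?case
    proof (intro impI ballI)
      fix f :: "real^'n \<Rightarrow> ennreal" assume nz: "det (A ** B) \<noteq> 0" and [measurable]: "f \<in> borel_measurable borel"
      then have "(\<integral>\<^sup>+x. f x \<partial>lborel) = ennreal \<bar>det A\<bar> * (\<integral>\<^sup>+x. f (A *v x) \<partial>lborel)"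
        using 1(1) nz by (auto simp only: det_mul mult_eq_0_iff)
      also have "(\<integral>\<^sup>+x. f (A *v x) \<partial>lborel) = ennreal \<bar>det B\<bar> * (\<integral>\<^sup>+x. f (A *v (B *v x)) \<partial>lborel)"
        by (rule 1(2)[rule_format, of "\<lambda>x. f (A *v x)"]) (use nz in \<open>auto simp: det_mul\<close>)
      finally show "(\<integral>\<^sup>+x. f x \<partial>lborel) = ennreal \<bar>det (A ** B)\<bar> * (\<integral>\<^sup>+x. f ((A ** B) *v x) \<partial>lborel)"
        by (simp add: det_mul abs_mult ennreal_mult mult.assoc matrix_vector_mul_assoc)
    qed
  next
    case (2 A i)
    then show ?case by (simp add: det_zero_row(2))
  next
    case (3 A)
    then show ?case by (blast intro: nn_integral_lborel_diagonal)
  next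
    case (4 m n)
    let ?p = "Transposition.transpose m n"
    have p: "?p permutes UNIV" by (simp add: permutes_swap_id)
    let ?S = "(\<chi> i j. mat 1 $ i $ ?p j) :: real^'n^'n"
    have "det ?S = of_int (sign ?p) * det (mat 1 :: real^'n^'n)"
      by (rule det_permute_columns[OF p])
    then have det: "\<bar>det ?S\<bar> = 1" by (auto simp: sign_def)
    have S: "?S *v x = (\<chi> i. x $ ?p i)" for x
    proof -
      have "(\<Sum>j\<in>UNIV. (if i = ?p j then 1 else 0) * x $ j) = x $ ?p i" for i
      proof -
        have "i = ?p j \<longleftrightarrow> j = ?p i" for j by (metis transpose_involutory)
        then have "(if i = ?p j then 1 else 0) * x $ j = (if j = ?p i then x $ j else 0)" for j
          by simp
        then show ?thesis by simp
      qed
      then show ?thesis by (simp add: vec_eq_iff matrix_vector_mult_def mat_def)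
    qed
    show ?case using nn_integral_lborel_permute[OF p] by (simp add: det S del: vec_lambda_beta)
  next
    case (5 m n)
    let ?E = "(\<chi> i j. of_bool (i = m \<and> j = n \<or> i = j)) :: real^'n^'n"
    have "?E = (\<chi> k. if k = m then row m (mat 1) + 1 *s row n (mat 1) else row k (mat 1))"
      using 5 by (auto simp: vec_eq_iff row_def mat_def)
    then have det: "det ?E = 1"
      using det_row_operation[OF 5, of "mat 1 :: real^'n^'n" 1] by simp
    have E: "?E *v x = x + (x $ n) *\<^sub>R axis m 1" for x
    proof -
      have "(\<Sum>j\<in>UNIV. of_bool (i = m \<and> j = n \<or> i = j) * x $ j) = x $ i + x $ n * (if i = m then 1 else 0)" for i
      proof -
        have "of_bool (i = m \<and> j = n \<or> i = j) * x $ j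
            = (if j = i then x $ j else 0) + (if j = n then x $ j * (if i = m then 1 else 0) else 0)" for j
          using 5 by auto
        then show ?thesis by (simp add: sum.distrib)
      qed
      then show ?thesis by (simp add: vec_eq_iff matrix_vector_mult_def axis_def)
    qed
    show ?case
    proof (intro impI ballI)
      fix f :: "real^'n \<Rightarrow> ennreal" assume [measurable]: "f \<in> borel_measurable borel"
      have "(\<integral>\<^sup>+x. f (x + (x $ n) *\<^sub>R axis m 1) \<partial>lborel) = (\<integral>\<^sup>+x. f x \<partial>lborel)"
        using 5 by (intro nn_integral_lborel_shear) (auto simp: Basis_vec_def, simp add: axis_def)
      then show "(\<integral>\<^sup>+x. f x \<partial>lborel) = ennreal \<bar>det ?E\<bar> * (\<integral>\<^sup>+x. f (?E *v x) \<partial>lborel)"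
        by (simp only: det E) simp
    qed
  qed
  with assms show ?thesis by blast
qed

section \<open>Nondegenerate Gaussian laws\<close>

text \<open>The integrand is a product over the coordinates of one-dimensional Gaussian densities.\<close>

lemma nn_integral_gaussian_standard:
  "(\<integral>\<^sup>+x. ennreal (exp (- (x \<bullet> x) / 2)) \<partial>(lborel :: (real^'n) measure)) = ennreal (sqrt ((2 * pi) ^ CARD('n)))"
proof -
  have one: "(\<integral>\<^sup>+t. ennreal (exp (- t\<^sup>2 / 2)) \<partial>lborel) = ennreal (sqrt (2 * pi))"
  proof -
    have "(\<integral>\<^sup>+t. ennreal (std_normal_density t) \<partial>lborel) = 1"
      by (subst nn_integral_eq_integral) (auto simp: integrable_normal_density)
    moreover have "exp (- t\<^sup>2 / 2) = sqrt (2 * pi) * std_normal_density t" for t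
      by (simp add: std_normal_density_def)
    ultimately show ?thesis by (simp add: ennreal_mult nn_integral_cmult)
  qed
  have "ennreal (exp (- (x \<bullet> x) / 2)) = (\<Prod>b\<in>Basis. ennreal (exp (- (x \<bullet> b)\<^sup>2 / 2)))" for x :: "real^'n"
    by (subst euclidean_inner)
       (simp add: prod_ennreal exp_sum[symmetric] sum_negf sum_divide_distrib power2_eq_square)
  then have "(\<integral>\<^sup>+x. ennreal (exp (- (x \<bullet> x) / 2)) \<partial>(lborel :: (real^'n) measure))
      = (\<Prod>b\<in>(Basis :: (real^'n) set). \<integral>\<^sup>+t. ennreal (exp (- t\<^sup>2 / 2)) \<partial>lborel)"
    by (simp only: nn_integral_lborel_prod[of "\<lambda>_ t. ennreal (exp (- t\<^sup>2 / 2))"]) 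
       (subst nn_integral_lborel_prod, auto)
  also have "\<dots> = ennreal (sqrt ((2 * pi) ^ CARD('n)))"
    by (simp only: one prod_constant) (simp add: ennreal_power flip: real_sqrt_power)
  finally show ?thesis .
qed

text \<open>The columns of \<open>P\<close> are an orthonormal basis for the form of \<open>C\<close>; the determinant of \<open>P\<close> is the
  volume factor of this change of coordinates.\<close>

lemma positive_definite_coordinates:
  fixes C :: "real^'n^'n"
  assumes pd: "positive_definite C"
  obtains P :: "real^'n^'n" where "det P \<noteq> 0" and "(det P)\<^sup>2 * det C = 1"
    and "\<And>u. (P *v u) \<bullet> (C *v (P *v u)) = u \<bullet> u"
proof -
  obtain P :: "real^'n^'n" where P: "transpose P ** C ** P = mat 1"
    using positive_definite_whitening[OF pd] .
  have "det P * det C * det P = 1"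
    using arg_cong[OF P, of det] by (simp add: det_mul)
  then have det: "(det P)\<^sup>2 * det C = 1" by (simp add: power2_eq_square mult_ac)
  have quad: "(P *v u) \<bullet> (C *v (P *v u)) = u \<bullet> u" for u
  proof -
    have "(P *v u) \<bullet> (C *v (P *v u)) = u \<bullet> (transpose P *v (C *v (P *v u)))"
      by (simp only: inner_matrix_vector_transpose[of u "transpose P"] transpose_transpose)
    also have "transpose P *v (C *v (P *v u)) = (transpose P ** C ** P) *v u"
      by (simp only: matrix_vector_mul_assoc matrix_mul_assoc)
    finally show ?thesis by (simp add: P)
  qed
  have "det P \<noteq> 0" using det by auto
  with that det quad show thesis by blast
qed

lemma
  fixes C :: "real^'n^'n"
  assumes pd: "positive_definite C"
  shows positive_definite_det: "0 < det C"
    and nn_integral_gaussian: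
      "(\<integral>\<^sup>+x. ennreal (exp (- (x \<bullet> (C *v x)) / 2)) \<partial>lborel) = ennreal (sqrt ((2 * pi) ^ CARD('n) / det C))"
proof -
  obtain P :: "real^'n^'n" where nz: "det P \<noteq> 0" and det: "(det P)\<^sup>2 * det C = 1"
    and quad: "\<And>u. (P *v u) \<bullet> (C *v (P *v u)) = u \<bullet> u"
    using positive_definite_coordinates[OF pd] by blast
  from det show pos: "0 < det C"
    by (metis zero_less_mult_pos zero_less_one zero_less_power2 nz)
  have "(\<integral>\<^sup>+x. ennreal (exp (- (x \<bullet> (C *v x)) / 2)) \<partial>lborel)
      = ennreal \<bar>det P\<bar> * (\<integral>\<^sup>+u. ennreal (exp (- (u \<bullet> u) / 2)) \<partial>(lborel :: (real^'n) measure))"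
    by (subst nn_integral_lborel_linear[OF nz]) (measurable, simp only: quad)
  also have "\<dots> = ennreal (\<bar>det P\<bar> * sqrt ((2 * pi) ^ CARD('n)))"
    by (simp only: nn_integral_gaussian_standard) (simp flip: ennreal_mult)
  also have "\<bar>det P\<bar> = sqrt (1 / det C)"
    using det pos by (intro real_sqrt_unique[symmetric]) (simp_all add: field_simps)
  finally show "(\<integral>\<^sup>+x. ennreal (exp (- (x \<bullet> (C *v x)) / 2)) \<partial>lborel) = ennreal (sqrt ((2 * pi) ^ CARD('n) / det C))"
    by (simp add: real_sqrt_mult[symmetric])
qed

definition gaussian_density :: "real^'n \<Rightarrow> real^'n^'n \<Rightarrow> real^'n \<Rightarrow> real" where
  "gaussian_density m S v =
     exp (- ((v - m) \<bullet> (matrix_inv S *v (v - m))) / 2) / sqrt ((2 * pi) ^ CARD('n) * det S)"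

lemma multivariate_normal_eq_density:
  "multivariate_normal m S = density lborel (\<lambda>v. ennreal (gaussian_density m S v))"
  by (simp add: multivariate_normal_def gaussian_density_def)

lemma borel_measurable_gaussian_density [measurable]:
  assumes [measurable]: "f \<in> borel_measurable N" "g \<in> borel_measurable N"
  shows "(\<lambda>x. gaussian_density (f x) S (g x)) \<in> borel_measurable N"
  unfolding gaussian_density_def by measurable

lemma sets_multivariate_normal [measurable_cong, simp]: "sets (multivariate_normal m S) = sets borel"
  by (simp add: multivariate_normal_def)

lemma space_multivariate_normal [simp]: "space (multivariate_normal m S) = UNIV"
  by (simp add: multivariate_normal_def)

lemma nn_integral_multivariate_normal:
  assumes "f \<in> borel_measurable borel"
  shows "(\<integral>\<^sup>+v. f v \<partial>multivariate_normal m S) = (\<integral>\<^sup>+v. ennreal (gaussian_density m S v) * f v \<partial>lborel)"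
  using assms by (simp add: multivariate_normal_eq_density nn_integral_density)

lemma multivariate_normal_eq_distr_translate:
  "multivariate_normal m S = distr (multivariate_normal 0 S) borel (\<lambda>z. z + m)"
proof (rule measure_eqI)
  fix B assume "B \<in> sets (multivariate_normal m S)"
  then have B [measurable]: "B \<in> sets borel" by simp
  have "emeasure (multivariate_normal m S) B
      = (\<integral>\<^sup>+v. ennreal (gaussian_density m S v) * indicator B v \<partial>lborel)"
    by (simp add: nn_integral_multivariate_normal flip: nn_integral_indicator)
  also have "\<dots> = (\<integral>\<^sup>+z. ennreal (gaussian_density m S (z + m)) * indicator B (z + m) \<partial>lborel)"
    by (rule nn_integral_lborel_translate[symmetric]) measurable
  also have "\<dots> = (\<integral>\<^sup>+z. indicator B (z + m) \<partial>multivariate_normal 0 S)"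
    by (simp add: nn_integral_multivariate_normal gaussian_density_def)
  also have "\<dots> = emeasure (distr (multivariate_normal 0 S) borel (\<lambda>z. z + m)) B"
    by (simp add: nn_integral_distr flip: nn_integral_indicator)
  finally show "emeasure (multivariate_normal m S) B = emeasure (distr (multivariate_normal 0 S) borel (\<lambda>z. z + m)) B" .
qed simp

lemma matrix_inv_det:
  fixes A :: "real^'n^'n"
  assumes "invertible A"
  shows "det (matrix_inv A) = 1 / det A"
proof -
  have "det A * det (matrix_inv A) = 1"
    using arg_cong[OF matrix_inv_mult(1)[OF assms], of det] by (simp add: det_mul)
  moreover from this have "det A \<noteq> 0" by auto
  ultimately show ?thesis by (simp add: eq_divide_eq mult.commute)
qed

lemma prob_space_multivariate_normal:
  fixes S :: "real^'n^'n"
  assumes pd: "positive_definite S"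
  shows "prob_space (multivariate_normal m S)"
proof -
  define K where "K = sqrt ((2 * pi) ^ CARD('n) * det S)"
  have K: "0 < K" using positive_definite_det[OF pd] by (simp add: K_def)
  have density: "gaussian_density 0 S v = exp (- (v \<bullet> (matrix_inv S *v v)) / 2) / K" for v
    by (simp only: gaussian_density_def K_def diff_zero)
  have "emeasure (multivariate_normal 0 S) UNIV = (\<integral>\<^sup>+v. ennreal (gaussian_density 0 S v) \<partial>lborel)"
    using nn_integral_multivariate_normal[of "\<lambda>_. 1" 0 S] by simp
  also have "\<dots> = (\<integral>\<^sup>+v. ennreal (1 / K) * ennreal (exp (- (v \<bullet> (matrix_inv S *v v)) / 2)) \<partial>lborel)"
    using K by (intro nn_integral_cong) (simp add: density flip: ennreal_mult)
  also have "\<dots> = ennreal (1 / K) * ennreal (sqrt ((2 * pi) ^ CARD('n) / det (matrix_inv S)))"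
    by (subst nn_integral_cmult) (measurable, simp only: nn_integral_gaussian positive_definite_matrix_inv pd)
  also have "sqrt ((2 * pi) ^ CARD('n) / det (matrix_inv S)) = K"
    by (simp add: K_def matrix_inv_det positive_definite_invertible pd)
  also have "ennreal (1 / K) * ennreal K = 1"
    using K by (simp flip: ennreal_mult)
  finally interpret prob_space "multivariate_normal 0 S" by (intro prob_spaceI) simp
  show ?thesis
    by (subst multivariate_normal_eq_distr_translate) (rule prob_space_distr, simp)
qed

lemma positive_definite_scaleR:
  assumes "positive_definite A" and "0 < c"
  shows "positive_definite (c *\<^sub>R A)"
  using assms
  by (auto simp: positive_definite_def transpose_scalar scaleR_matrix_vector_assoc[symmetric])

text \<open>The mean is \<open>m\<close> because the centred law is invariant under \<open>z \<mapsto> - z\<close>. Integrability has to be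
  shown separately, the integral of a function that is not integrable being \<open>0\<close> by convention: half of the
  Gaussian exponent absorbs the factor \<open>norm z\<close>, and the other half still is a Gaussian integrand.\<close>

lemma
  fixes S :: "real^'n^'n"
  assumes pd: "positive_definite S"
  shows integrable_multivariate_normal: "integrable (multivariate_normal m S) (\<lambda>v. v)"
    and integral_multivariate_normal: "(\<integral>v. v \<partial>multivariate_normal m S) = m"
proof -
  define C where "C = matrix_inv S"
  define K where "K = sqrt ((2 * pi) ^ CARD('n) * det S)"
  have K: "0 < K" using positive_definite_det[OF pd] by (simp add: K_def)
  have pdC: "positive_definite C" by (simp add: C_def pd positive_definite_matrix_inv)
  obtain c where c: "0 < c" "\<And>w. c * (w \<bullet> w) \<le> w \<bullet> (C *v w)"
    using positive_definite_coercive[OF pdC] by blast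
  interpret N: prob_space "multivariate_normal 0 S" by (rule prob_space_multivariate_normal[OF pd])
  have density: "gaussian_density 0 S v = exp (- (v \<bullet> (C *v v)) / 2) / K" for v
    by (simp only: gaussian_density_def K_def C_def diff_zero)
  have bound: "norm z * gaussian_density 0 S z
      \<le> (1 + 4 / c) / K * exp (- (z \<bullet> (((1/2) *\<^sub>R C) *v z)) / 2)" for z
  proof -
    define Q where "Q = z \<bullet> (C *v z)"
    have Q: "c * (norm z)\<^sup>2 \<le> Q" using c(2)[of z] by (simp add: Q_def dot_square_norm)
    have "0 \<le> Q" using Q c(1) by (meson mult_nonneg_nonneg less_imp_le order_trans zero_le_power2)
    have "norm z \<le> 1 + (norm z)\<^sup>2"
      using zero_le_power2[of "norm z - 1/2"] by (simp add: power2_eq_square algebra_simps)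
    also have "\<dots> \<le> 1 + Q / c" using Q c(1) by (simp add: field_simps)
    \<comment> \<open>The constant \<open>1 + 4 / c\<close> dominates both coefficients of \<open>1 + Q / c\<close> relative to \<open>1 + Q / 4\<close>.\<close>
    also have "\<dots> \<le> (1 + 4 / c) * (1 + Q / 4)" using \<open>0 \<le> Q\<close> c(1) by (simp add: field_simps)
    also have "\<dots> \<le> (1 + 4 / c) * exp (Q / 4)"
      using c(1) by (intro mult_left_mono exp_ge_add_one_self) simp
    finally have "norm z * exp (- Q / 2) \<le> (1 + 4 / c) * exp (Q / 4) * exp (- Q / 2)"
      by (rule mult_right_mono) simp
    also have "\<dots> = (1 + 4 / c) * exp (- Q / 4)" by (simp add: mult.assoc flip: exp_add)
    finally have "norm z * exp (- Q / 2) / K \<le> (1 + 4 / c) * exp (- Q / 4) / K"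
      using K by (simp add: divide_right_mono)
    then show ?thesis
      by (simp add: density Q_def scaleR_matrix_vector_assoc[symmetric])
  qed
  have int: "integrable (multivariate_normal 0 S) (\<lambda>z. z)"
  proof (rule integrableI_bounded)
    have "(\<integral>\<^sup>+z. ennreal (norm z) \<partial>multivariate_normal 0 S)
        = (\<integral>\<^sup>+z. ennreal (norm z * gaussian_density 0 S z) \<partial>lborel)"
      by (subst nn_integral_multivariate_normal) (auto intro!: nn_integral_cong simp: ennreal_mult' mult.commute)
    also have "\<dots> \<le> (\<integral>\<^sup>+z. ennreal ((1 + 4 / c) / K) * ennreal (exp (- (z \<bullet> (((1/2) *\<^sub>R C) *v z)) / 2)) \<partial>lborel)"
      using K c(1) by (intro nn_integral_mono)
        (subst ennreal_mult[symmetric], simp, simp, rule ennreal_leI, rule bound)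
    also have "\<dots> = ennreal ((1 + 4 / c) / K) * ennreal (sqrt ((2 * pi) ^ CARD('n) / det ((1/2) *\<^sub>R C)))"
      by (subst nn_integral_cmult) (measurable, subst nn_integral_gaussian, auto intro!: positive_definite_scaleR pdC)
    also have "\<dots> < \<infinity>" by (simp add: ennreal_mult_less_top)
    finally show "(\<integral>\<^sup>+z. ennreal (norm z) \<partial>multivariate_normal 0 S) < \<infinity>" .
  qed simp
  have "(\<integral>z. z \<partial>multivariate_normal 0 S) = (\<integral>z. - z \<partial>multivariate_normal 0 S)"
  proof -
    have "(\<integral>z. z \<partial>multivariate_normal 0 S) = (\<integral>z. gaussian_density 0 S z *\<^sub>R z \<partial>lborel)"
      unfolding multivariate_normal_eq_density
      by (subst integral_density) (auto simp: density less_imp_le[OF K])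
    also have "\<dots> = (\<integral>z. gaussian_density 0 S (- z) *\<^sub>R (- z) \<partial>lborel)"
    proof -
      have "(lborel :: (real^'n) measure) = distr lborel borel uminus"
        using lborel_affine[of "-1" "0 :: real^'n"] by (simp add: density_1)
      then have "(\<integral>z. gaussian_density 0 S z *\<^sub>R z \<partial>lborel)
          = (\<integral>z. gaussian_density 0 S z *\<^sub>R z \<partial>distr lborel borel uminus)" by simp
      then show ?thesis by (simp add: integral_distr)
    qed
    also have "\<dots> = (\<integral>z. gaussian_density 0 S z *\<^sub>R (- z) \<partial>lborel)"
      by (simp add: density linear_neg[OF matrix_vector_mul_linear])
    also have "\<dots> = (\<integral>z. - z \<partial>multivariate_normal 0 S)"
      unfolding multivariate_normal_eq_density
      by (subst integral_density) (auto simp: density less_imp_le[OF K])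
    finally show ?thesis .
  qed
  then have zero: "(\<integral>z. z \<partial>multivariate_normal 0 S) = 0"
    by (simp add: vec_eq_iff)
  show "integrable (multivariate_normal m S) (\<lambda>v. v)"
    by (subst multivariate_normal_eq_distr_translate) (simp add: integrable_distr_eq int)
  show "(\<integral>v. v \<partial>multivariate_normal m S) = m"
    by (subst multivariate_normal_eq_distr_translate) (use N.prob_space in \<open>simp add: integral_distr int zero\<close>)
qed

text \<open>In the coordinates of \<open>positive_definite_coordinates\<close> the level set is a sphere, or empty when
  \<open>r < 0\<close>.\<close>

lemma null_sets_level_set:
  fixes C :: "real^'n^'n"
  assumes pd: "positive_definite C"
  shows "{z. z \<bullet> (C *v z) = r} \<in> null_sets lborel"
proof -
  obtain P :: "real^'n^'n" where nz: "det P \<noteq> 0"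
    and quad: "\<And>u. (P *v u) \<bullet> (C *v (P *v u)) = u \<bullet> u"
    using positive_definite_coordinates[OF pd] by blast
  have "{u :: real^'n. u \<bullet> u = r} \<subseteq> sphere 0 (sqrt r)"
    by (auto simp: norm_eq_sqrt_inner)
  then have "negligible {u :: real^'n. u \<bullet> u = r}"
    using negligible_sphere negligible_subset by blast
  moreover have [measurable]: "{u :: real^'n. u \<bullet> u = r} \<in> sets borel" by measurable
  ultimately have null: "emeasure lborel {u :: real^'n. u \<bullet> u = r} = 0"
    by (simp add: negligible_iff_null_sets null_sets_completion_iff null_setsD1)
  have [measurable]: "{z. z \<bullet> (C *v z) = r} \<in> sets borel" by measurable
  have "emeasure lborel {z. z \<bullet> (C *v z) = r} = (\<integral>\<^sup>+z. indicator {z. z \<bullet> (C *v z) = r} z \<partial>lborel)"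
    by simp
  also have "\<dots> = ennreal \<bar>det P\<bar> * (\<integral>\<^sup>+u. indicator {z. z \<bullet> (C *v z) = r} (P *v u) \<partial>lborel)"
    by (rule nn_integral_lborel_linear[OF nz]) measurable
  also have "(\<lambda>u. indicator {z. z \<bullet> (C *v z) = r} (P *v u)) = (indicator {u. u \<bullet> u = r} :: _ \<Rightarrow> ennreal)"
    by (auto simp: fun_eq_iff indicator_def quad)
  finally have "emeasure lborel {z. z \<bullet> (C *v z) = r} = 0" by (simp add: null)
  then show ?thesis by (simp add: null_sets_def)
qed

lemma multivariate_normal_level_set:
  assumes "positive_definite C"
  shows "measure (multivariate_normal m S) {z. z \<bullet> (C *v z) = r} = 0"
proof -
  have "emeasure (multivariate_normal m S) {z. z \<bullet> (C *v z) = r} = 0"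
    using null_sets_level_set[OF assms, of r] absolutely_continuousI_density[of "\<lambda>v. ennreal (gaussian_density m S v)" lborel]
    unfolding multivariate_normal_eq_density absolutely_continuous_def by auto
  then show ?thesis by (simp add: measure_def)
qed

lemma multivariate_normal_kernel:
  fixes A :: "real^'n^'n"
  assumes pd: "positive_definite A" and [measurable]: "\<mu> \<in> borel_measurable N"
  shows "(\<lambda>x. multivariate_normal (\<mu> x) A) \<in> N \<rightarrow>\<^sub>M prob_algebra borel"
proof (intro measurable_prob_algebraI measurable_subprob_algebra)
  show "prob_space (multivariate_normal (\<mu> x) A)" for x
    by (rule prob_space_multivariate_normal[OF pd])
  then show "subprob_space (multivariate_normal (\<mu> x) A)" for x
    by (rule prob_space_imp_subprob_space)
  fix B :: "(real^'n) set" assume [measurable]: "B \<in> sets borel"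
  have "emeasure (multivariate_normal (\<mu> x) A) B
      = (\<integral>\<^sup>+y. ennreal (gaussian_density (\<mu> x) A y) * indicator B y \<partial>lborel)" for x
    by (simp add: nn_integral_multivariate_normal flip: nn_integral_indicator)
  then show "(\<lambda>x. emeasure (multivariate_normal (\<mu> x) A) B) \<in> borel_measurable N" by simp
qed simp

section \<open>Block vectors and the Schur complement\<close>

definition upper_part :: "real^('k::finite + 'l::finite) \<Rightarrow> real^'k" where
  "upper_part v = (\<chi> i. v $ Inl i)"

definition lower_part :: "real^('k::finite + 'l::finite) \<Rightarrow> real^'l" where
  "lower_part v = (\<chi> i. v $ Inr i)"

lemma stack_nth [simp]: "stack x y $ Inl i = x $ i" "stack x y $ Inr j = y $ j"
  by (simp_all add: stack_def)

lemma parts_stack [simp]: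
  "upper_part (stack x y) = x" "lower_part (stack x y) = y" "stack (upper_part v) (lower_part v) = v"
  by (simp_all add: upper_part_def lower_part_def vec_eq_iff stack_def split: sum.split)

lemma stack_eq_0_iff: "stack x y = 0 \<longleftrightarrow> x = 0 \<and> y = 0"
  by (simp add: vec_eq_iff split_sum_all)

lemma stack_diff: "stack a b - stack c d = stack (a - c) (b - d)"
  by (simp add: vec_eq_iff stack_def split: sum.split)

lemma sum_UNIV_Plus:
  fixes f :: "'k::finite + 'l::finite \<Rightarrow> 'b::comm_monoid_add"
  shows "sum f UNIV = (\<Sum>i\<in>UNIV. f (Inl i)) + (\<Sum>j\<in>UNIV. f (Inr j))"
  by (simp flip: UNIV_Plus_UNIV add: sum.Plus)

lemma prod_UNIV_Plus:
  fixes f :: "'k::finite + 'l::finite \<Rightarrow> 'b::comm_monoid_mult"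
  shows "prod f UNIV = (\<Prod>i\<in>UNIV. f (Inl i)) * (\<Prod>j\<in>UNIV. f (Inr j))"
  by (simp flip: UNIV_Plus_UNIV add: prod.Plus)

lemma inner_stack: "stack a b \<bullet> stack c d = a \<bullet> c + b \<bullet> d"
  by (simp add: inner_vec_def sum_UNIV_Plus)

lemma matrix_vector_mult_stack:
  "S *v stack p q = stack (block11 S *v p + block12 S *v q) (block21 S *v p + block22 S *v q)"
proof -
  have "(S *v stack p q) $ i
      = stack (block11 S *v p + block12 S *v q) (block21 S *v p + block22 S *v q) $ i" for i
    by (cases i) (simp_all add: matrix_vector_mult_def sum_UNIV_Plus block11_def block12_def block21_def block22_def)
  then show ?thesis by (simp add: vec_eq_iff)
qed

lemma bounded_linear_parts: "bounded_linear upper_part" "bounded_linear lower_part"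
  by (intro linear_conv_bounded_linear[THEN iffD1] linearI;
      simp add: upper_part_def lower_part_def vec_eq_iff)+

lemma borel_measurable_parts [measurable]:
  "upper_part \<in> borel_measurable borel" "lower_part \<in> borel_measurable borel"
  using bounded_linear_parts by (auto intro: borel_measurable_continuous_onI linear_continuous_on)

lemma borel_measurable_stack [measurable (raw)]:
  assumes [measurable]: "f \<in> borel_measurable N" "g \<in> borel_measurable N"
  shows "(\<lambda>x. stack (f x) (g x)) \<in> borel_measurable N"
proof -
  have "linear (\<lambda>p. stack (fst p) (snd p) :: real^('k::finite + 'l::finite))"
    by (intro linearI) (simp_all add: vec_eq_iff stack_def split: sum.split)
  then have [measurable]: "(\<lambda>p. stack (fst p) (snd p) :: real^('k::finite + 'l::finite)) \<in> borel_measurable (borel \<Otimes>\<^sub>M borel)"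
    unfolding borel_prod
    by (intro borel_measurable_continuous_onI linear_continuous_on) (simp add: linear_conv_bounded_linear)
  have "(\<lambda>x. stack (fst (f x, g x)) (snd (f x, g x))) \<in> borel_measurable N" by measurable
  then show ?thesis by simp
qed

text \<open>Tonelli for vectors in two blocks: \<open>stack\<close> carries products of boxes to boxes of the same volume,
  hence the product of the two Lebesgue measures to Lebesgue measure.\<close>

lemma nn_integral_lborel_stack:
  fixes f :: "real^('k::finite + 'l::finite) \<Rightarrow> ennreal"
  assumes [measurable]: "f \<in> borel_measurable borel"
  shows "(\<integral>\<^sup>+v. f v \<partial>lborel) = (\<integral>\<^sup>+x. (\<integral>\<^sup>+y. f (stack x y) \<partial>lborel) \<partial>lborel)"
proof -
  let ?T = "\<lambda>p. stack (fst p) (snd p) :: real^('k + 'l)"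
  have "lborel = distr (lborel \<Otimes>\<^sub>M lborel) borel ?T"
  proof (rule lborel_eqI)
    fix l u :: "real^('k + 'l)" assume le: "\<And>b. b \<in> Basis \<Longrightarrow> l \<bullet> b \<le> u \<bullet> b"
    have le': "l $ i \<le> u $ i" for i using le[of "axis i 1"] by (simp add: inner_axis)
    have pre: "?T -` box l u \<inter> space (lborel \<Otimes>\<^sub>M lborel)
        = box (upper_part l) (upper_part u) \<times> box (lower_part l) (lower_part u)"
      by (auto simp: mem_box_cart upper_part_def lower_part_def space_pair_measure)
         (metis (full_types) stack_nth old.sum.exhaust)+
    have "emeasure (distr (lborel \<Otimes>\<^sub>M lborel) borel ?T) (box l u)
        = emeasure lborel (box (upper_part l) (upper_part u)) * emeasure lborel (box (lower_part l) (lower_part u))"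
      by (simp add: emeasure_distr pre lborel.emeasure_pair_measure_Times)
    also have "emeasure lborel (box (upper_part l) (upper_part u)) = (\<Prod>i\<in>UNIV. u $ Inl i - l $ Inl i)"
      using le' by (simp add: emeasure_lborel_box_cart upper_part_def)
    also have "emeasure lborel (box (lower_part l) (lower_part u)) = (\<Prod>i\<in>UNIV. u $ Inr i - l $ Inr i)"
      using le' by (simp add: emeasure_lborel_box_cart lower_part_def)
    also have "ennreal (\<Prod>i\<in>UNIV. u $ Inl i - l $ Inl i) * ennreal (\<Prod>i\<in>UNIV. u $ Inr i - l $ Inr i)
        = (\<Prod>b\<in>Basis. (u - l) \<bullet> b)"
      using le' by (simp add: prod_Basis_cart inner_axis prod_UNIV_Plus prod_nonneg flip: ennreal_mult)
    finally show "emeasure (distr (lborel \<Otimes>\<^sub>M lborel) borel ?T) (box l u) = (\<Prod>b\<in>Basis. (u - l) \<bullet> b)" .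
  qed simp
  then have "(\<integral>\<^sup>+v. f v \<partial>lborel) = (\<integral>\<^sup>+v. f v \<partial>distr (lborel \<Otimes>\<^sub>M lborel) borel ?T)" by simp
  also have "\<dots> = (\<integral>\<^sup>+p. f (?T p) \<partial>(lborel \<Otimes>\<^sub>M lborel))" by (simp add: nn_integral_distr)
  also have "\<dots> = (\<integral>\<^sup>+x. (\<integral>\<^sup>+y. f (stack x y) \<partial>lborel) \<partial>lborel)"
    by (subst lborel.nn_integral_fst[symmetric]) auto
  finally show ?thesis .
qed

lemma transpose_blocks:
  assumes "transpose S = S"
  shows "transpose (block11 S) = block11 S" "transpose (block12 S) = block21 S"
    "transpose (block21 S) = block12 S" "transpose (block22 S) = block22 S"
proof -
  have "S $ i $ j = S $ j $ i" for i j
    using arg_cong[OF assms, of "\<lambda>A. A $ j $ i"] by (simp add: transpose_def)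
  then show "transpose (block11 S) = block11 S" "transpose (block12 S) = block21 S"
    "transpose (block21 S) = block12 S" "transpose (block22 S) = block22 S"
    by (simp_all add: transpose_def vec_eq_iff block11_def block12_def block21_def block22_def)
qed

lemma A_inf_mult:
  "A_inf S *v q = block22 S *v q - regression_matrix S *v (block12 S *v q)"
  by (simp add: A_inf_def regression_matrix_def matrix_vector_mult_diff_rdistrib matrix_vector_mul_assoc matrix_mul_assoc)

lemma positive_definite_block11:
  assumes pd: "positive_definite S"
  shows "positive_definite (block11 S)"
  unfolding positive_definite_def
proof (intro conjI allI impI)
  show "transpose (block11 S) = block11 S"
    using pd by (simp add: positive_definite_def transpose_blocks)
  fix p :: "real^'a" assume "p \<noteq> 0"
  then have "stack p (0 :: real^'b) \<noteq> 0" by (simp add: stack_eq_0_iff)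
  then have "0 < stack p (0 :: real^'b) \<bullet> (S *v stack p 0)" using pd by (simp add: positive_definite_def)
  then show "0 < p \<bullet> (block11 S *v p)" by (simp add: matrix_vector_mult_stack inner_stack)
qed

lemma regression_matrix_block11:
  assumes pd: "positive_definite S"
  shows "regression_matrix S *v (block11 S *v p) = block21 S *v p"
  using matrix_inv_cancel(2)[OF positive_definite_invertible[OF positive_definite_block11[OF pd]]]
  by (simp add: regression_matrix_def matrix_vector_mul_assoc[symmetric])

lemma transpose_regression_matrix:
  assumes pd: "positive_definite S"
  shows "transpose (regression_matrix S) = matrix_inv (block11 S) ** block12 S"
proof -
  have "transpose (matrix_inv (block11 S)) = matrix_inv (block11 S)"
    using positive_definite_matrix_inv[OF positive_definite_block11[OF pd]] by (simp add: positive_definite_def)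
  then show ?thesis
    using pd by (simp add: regression_matrix_def matrix_transpose_mul transpose_blocks positive_definite_def)
qed

text \<open>The form of the Schur complement at \<open>q\<close> is the form of \<open>S\<close> at the vector \<open>(p, q)\<close> whose \<open>p\<close> is
  chosen so that the upper block of \<open>S (p, q)\<close> vanishes.\<close>

lemma positive_definite_A_inf:
  assumes pd: "positive_definite S"
  shows "positive_definite (A_inf S)"
  unfolding positive_definite_def
proof (intro conjI allI impI)
  have sym: "transpose S = S" using pd by (simp add: positive_definite_def)
  have tdiff: "transpose (A - B) = transpose A - transpose B" for A B :: "real^'b^'b"
    by (simp add: transpose_def vec_eq_iff)
  have "transpose (A_inf S) = block22 S - transpose (block12 S) ** transpose (regression_matrix S)"
    by (simp add: A_inf_def tdiff matrix_transpose_mul transpose_blocks[OF sym] flip: regression_matrix_def)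
  then show "transpose (A_inf S) = A_inf S"
    by (simp add: transpose_regression_matrix[OF pd] transpose_blocks[OF sym] A_inf_def matrix_mul_assoc)
  fix q :: "real^'b" assume "q \<noteq> 0"
  define p where "p = - (matrix_inv (block11 S) *v (block12 S *v q))"
  have p11: "block11 S *v p = - (block12 S *v q)"
    using matrix_inv_cancel(1)[OF positive_definite_invertible[OF positive_definite_block11[OF pd]]]
    by (simp add: p_def linear_neg[OF matrix_vector_mul_linear])
  have "block21 S *v p + block22 S *v q = A_inf S *v q"
    using regression_matrix_block11[OF pd, of p]
    by (simp add: p11 A_inf_mult linear_neg[OF matrix_vector_mul_linear])
  then have "S *v stack p q = stack 0 (A_inf S *v q)" by (simp add: matrix_vector_mult_stack p11)
  moreover have "stack p q \<noteq> 0"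
    using \<open>q \<noteq> 0\<close> by (simp add: stack_eq_0_iff)
  ultimately show "0 < q \<bullet> (A_inf S *v q)"
    using pd unfolding positive_definite_def by (metis inner_stack inner_zero_right add_0)
qed

text \<open>Completion of the square by elimination: with
  \<open>(p, q)\<close> the preimage of \<open>(a, b)\<close> under \<open>S\<close>, eliminating \<open>p\<close> from the two block equations turns the
  residual of \<open>b\<close> into \<open>A_inf S\<close> applied to \<open>q\<close>, and both sides become \<open>a \<bullet> p + b \<bullet> q\<close>.\<close>

lemma quadratic_form_stack:
  assumes pd: "positive_definite S"
  shows "stack a b \<bullet> (matrix_inv S *v stack a b)
    = a \<bullet> (matrix_inv (block11 S) *v a)
      + (b - regression_matrix S *v a) \<bullet> (matrix_inv (A_inf S) *v (b - regression_matrix S *v a))"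
proof -
  define p where "p = upper_part (matrix_inv S *v stack a b)"
  define q where "q = lower_part (matrix_inv S *v stack a b)"
  have pq: "matrix_inv S *v stack a b = stack p q" by (simp add: p_def q_def)
  then have "stack a b = S *v stack p q"
    using matrix_inv_cancel(1)[OF positive_definite_invertible[OF pd], of "stack a b"] by simp
  then have "upper_part (stack a b) = upper_part (S *v stack p q)"
    "lower_part (stack a b) = lower_part (S *v stack p q)" by simp_all
  then have a: "a = block11 S *v p + block12 S *v q" and b: "b = block21 S *v p + block22 S *v q"
    by (simp_all add: matrix_vector_mult_stack)
  have res: "b - regression_matrix S *v a = A_inf S *v q"
    by (simp add: a b A_inf_mult matrix_vector_right_distrib regression_matrix_block11[OF pd])
  have inv11: "matrix_inv (block11 S) *v a = p + transpose (regression_matrix S) *v q"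
    using matrix_inv_cancel(2)[OF positive_definite_invertible[OF positive_definite_block11[OF pd]]]
    by (simp add: a matrix_vector_right_distrib transpose_regression_matrix[OF pd] matrix_vector_mul_assoc[symmetric])
  have "a \<bullet> (matrix_inv (block11 S) *v a) = a \<bullet> p + (regression_matrix S *v a) \<bullet> q"
    unfolding inv11 inner_add_right by (simp only: inner_matrix_vector_transpose[of a] transpose_transpose)
  moreover have "(A_inf S *v q) \<bullet> (matrix_inv (A_inf S) *v (A_inf S *v q)) = b \<bullet> q - (regression_matrix S *v a) \<bullet> q"
    using matrix_inv_cancel(2)[OF positive_definite_invertible[OF positive_definite_A_inf[OF pd]], of q]
    by (simp add: res[symmetric] inner_diff_left)
  ultimately show ?thesis by (simp add: pq inner_stack res)
qed

section \<open>Disintegration of a Gaussian vector\<close>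

text \<open>The conditional mean of the lower block of \<open>N(m, S)\<close> given that the upper block equals \<open>x\<close>.\<close>

definition regression_mean ::
    "real^('k::finite + 'l::finite) \<Rightarrow> real^('k + 'l)^('k + 'l) \<Rightarrow> real^'k \<Rightarrow> real^'l" where
  "regression_mean m S x = lower_part m + regression_matrix S *v (x - upper_part m)"

lemma borel_measurable_regression_mean [measurable]: "regression_mean m S \<in> borel_measurable borel"
  unfolding regression_mean_def by measurable

text \<open>The joint density at \<open>(x, y)\<close> is \<open>g x\<close> times the density at \<open>y\<close> of the conditional normal law.
  The latter has total mass one, so integrating over \<open>y\<close> shows that \<open>g\<close> is the density of the upper
  block.\<close>

theorem multivariate_normal_disintegration:
  fixes S :: "real^('k::finite + 'l::finite)^('k + 'l)"
  assumes pd: "positive_definite S" and h [measurable]: "h \<in> borel_measurable borel"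
  shows "(\<integral>\<^sup>+v. h v \<partial>multivariate_normal m S)
    = (\<integral>\<^sup>+x. (\<integral>\<^sup>+y. h (stack x y) \<partial>multivariate_normal (regression_mean m S x) (A_inf S))
         \<partial>distr (multivariate_normal m S) borel upper_part)"
proof -
  let ?N = "multivariate_normal m S"
  let ?K = "\<lambda>x. multivariate_normal (regression_mean m S x) (A_inf S)"
  note pdA = positive_definite_A_inf[OF pd]
  define c where "c = sqrt ((2 * pi) ^ CARD('k + 'l) * det S)"
  define d where "d = sqrt ((2 * pi) ^ CARD('l) * det (A_inf S))"
  have d: "0 < d" using positive_definite_det[OF pdA] by (simp add: d_def)
  have c: "0 < c" using positive_definite_det[OF pd] by (simp add: c_def)
  \<comment> \<open>The ratio of the two normalising constants makes the factorisation below exact; that it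
    also normalises \<open>g\<close> comes out of the integration.\<close>
  define g where "g x = d / c * exp (- ((x - upper_part m) \<bullet> (matrix_inv (block11 S) *v (x - upper_part m))) / 2)" for x
  have g_meas [measurable]: "g \<in> borel_measurable borel" unfolding g_def by measurable
  have factor: "gaussian_density m S (stack x y) = g x * gaussian_density (regression_mean m S x) (A_inf S) y" for x y
  proof -
    have diff: "stack x y - m = stack (x - upper_part m) (y - lower_part m)"
      using stack_diff[of x y "upper_part m" "lower_part m"] by simp
    have res: "y - lower_part m - regression_matrix S *v (x - upper_part m) = y - regression_mean m S x"
      by (simp add: regression_mean_def)
    have sum: "exp (- (s + t) / 2) = exp (- s / 2) * exp (- t / 2)" for s t :: real
      by (simp add: field_simps flip: exp_add)
    show ?thesis
      unfolding gaussian_density_def c_def[symmetric] d_def[symmetric] g_def diff quadratic_form_stack[OF pd] res sum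
      using c d by simp
  qed
  have kernel [measurable]: "?K \<in> borel \<rightarrow>\<^sub>M subprob_algebra borel"
    by (intro measurable_prob_algebraD multivariate_normal_kernel pdA) measurable
  have dis: "(\<integral>\<^sup>+v. f v \<partial>?N) = (\<integral>\<^sup>+x. ennreal (g x) * (\<integral>\<^sup>+y. f (stack x y) \<partial>?K x) \<partial>lborel)"
    if [measurable]: "f \<in> borel_measurable borel" for f
  proof -
    have "(\<integral>\<^sup>+v. f v \<partial>?N)
        = (\<integral>\<^sup>+x. (\<integral>\<^sup>+y. ennreal (gaussian_density m S (stack x y)) * f (stack x y) \<partial>lborel) \<partial>lborel)"
      by (subst nn_integral_multivariate_normal, simp, rule nn_integral_lborel_stack) measurable
    also have "\<dots> = (\<integral>\<^sup>+x. ennreal (g x) * (\<integral>\<^sup>+y. f (stack x y) \<partial>?K x) \<partial>lborel)"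
    proof (rule nn_integral_cong)
      fix x :: "real^'k"
      have "0 \<le> g x" using c d by (simp add: g_def)
      then show "(\<integral>\<^sup>+y. ennreal (gaussian_density m S (stack x y)) * f (stack x y) \<partial>lborel)
          = ennreal (g x) * (\<integral>\<^sup>+y. f (stack x y) \<partial>?K x)"
        by (simp add: factor ennreal_mult' mult.assoc nn_integral_cmult nn_integral_multivariate_normal)
    qed
    finally show ?thesis .
  qed
  have "distr ?N borel upper_part = density lborel (\<lambda>x. ennreal (g x))"
  proof (rule measure_eqI)
    fix B :: "(real^'k) set" assume "B \<in> sets (distr ?N borel upper_part)"
    then have [measurable]: "B \<in> sets borel" by simp
    have "emeasure (distr ?N borel upper_part) B = (\<integral>\<^sup>+v. indicator B (upper_part v) \<partial>?N)"
      by (simp add: nn_integral_distr flip: nn_integral_indicator)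
    also have "\<dots> = (\<integral>\<^sup>+x. ennreal (g x) * indicator B x \<partial>lborel)"
    proof -
      interpret K: prob_space "?K x" for x by (rule prob_space_multivariate_normal[OF pdA])
      show ?thesis using K.emeasure_space_1 by (subst dis) simp_all
    qed
    also have "\<dots> = emeasure (density lborel (\<lambda>x. ennreal (g x))) B"
      by (simp add: emeasure_density)
    finally show "emeasure (distr ?N borel upper_part) B = emeasure (density lborel (\<lambda>x. ennreal (g x))) B" .
  qed simp
  moreover have "(\<lambda>x. \<integral>\<^sup>+y. h (stack x y) \<partial>?K x) \<in> borel_measurable borel"
    by (rule nn_integral_measurable_subprob_algebra2[OF _ kernel]) simp
  ultimately show ?thesis
    by (simp add: dis nn_integral_density)
qed

section \<open>Quantiles of atomless random variables\<close>

text \<open>Without atoms the distribution function is continuous, so by the intermediate value theorem it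
  takes the value \<open>1 - \<alpha>\<close>, and it takes it in particular at the least point where it reaches
  \<open>1 - \<alpha>\<close>, which is the upper quantile.\<close>

lemma measure_le_upper_quantile:
  fixes \<xi> :: "'a \<Rightarrow> real"
  assumes "prob_space M" and \<xi> [measurable]: "\<xi> \<in> borel_measurable M"
    and atomless: "\<And>r. measure M {\<omega> \<in> space M. \<xi> \<omega> = r} = 0"
    and \<alpha>: "0 < \<alpha>" "\<alpha> < 1"
  shows "measure M {\<omega> \<in> space M. \<xi> \<omega> \<le> upper_quantile M \<alpha> \<xi>} = 1 - \<alpha>"
proof -
  interpret prob_space M by fact
  define D where "D = distr M borel \<xi>"
  interpret D: real_distribution D
    unfolding D_def by (rule real_distribution_distr) measurable
  have F: "cdf D r = measure M {\<omega> \<in> space M. \<xi> \<omega> \<le> r}" for r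
    unfolding cdf_def D_def by (subst measure_distr) (auto intro!: arg_cong[where f="measure M"])
  have gt: "measure M {\<omega> \<in> space M. \<xi> \<omega> > r} = 1 - cdf D r" for r
  proof -
    have "{\<omega> \<in> space M. \<xi> \<omega> > r} = space M - {\<omega> \<in> space M. \<xi> \<omega> \<le> r}" by auto
    then show ?thesis using prob_compl[of "{\<omega> \<in> space M. \<xi> \<omega> \<le> r}"] by (simp add: F)
  qed
  have cont: "isCont (cdf D) r" for r
  proof -
    have "measure D {r} = measure M {\<omega> \<in> space M. \<xi> \<omega> = r}"
      unfolding D_def by (subst measure_distr) (auto intro!: arg_cong[where f="measure M"])
    then show ?thesis by (simp add: D.isCont_cdf atomless)
  qed
  define A where "A = {r. 1 - \<alpha> \<le> cdf D r}"
  have q: "upper_quantile M \<alpha> \<xi> = Inf A"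
    by (simp add: upper_quantile_def A_def gt algebra_simps)
  obtain a where a: "cdf D a < 1 - \<alpha>"
    using order_tendstoD(2)[OF D.cdf_lim_at_bot, of "1 - \<alpha>"] \<alpha>
    by (auto simp: eventually_at_bot_linorder)
  obtain b where b: "1 - \<alpha> < cdf D b"
    using order_tendstoD(1)[OF D.cdf_lim_at_top_prob, of "1 - \<alpha>"] \<alpha>
    by (auto simp: eventually_at_top_linorder)
  have "a \<le> b"
    using a b D.cdf_nondecreasing[of b a] by (cases "a \<le> b") auto
  then obtain r where r: "cdf D r = 1 - \<alpha>"
    using IVT[of "cdf D" a "1 - \<alpha>" b] a b cont by auto
  have "a \<le> s" if "s \<in> A" for s
    using that a D.cdf_nondecreasing[of s a] by (cases "a \<le> s") (auto simp: A_def)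
  then have bdd: "bdd_below A" by (rule bdd_belowI)
  have "closed A"
    unfolding A_def using cont by (intro closed_Collect_le continuous_intros) (auto simp: continuous_on_eq_continuous_at)
  moreover have "A \<noteq> {}" using r by (auto simp: A_def intro!: exI[of _ r])
  ultimately have "Inf A \<in> A"
    using bdd by (intro closed_contains_Inf)
  moreover have "Inf A \<le> r" using bdd r by (intro cInf_lower) (auto simp: A_def)
  ultimately have "cdf D (Inf A) = 1 - \<alpha>"
    using D.cdf_nondecreasing[of "Inf A" r] r by (simp add: A_def)
  then show ?thesis by (simp add: q F)
qed

section \<open>Coverage of the prediction ellipsoid\<close>

text \<open>Both coverage probabilities are the mass of \<open>{z. \<xi> z \<le> q}\<close> under \<open>N(0, A_inf \<Sigma>)\<close>: this is the
  law of \<open>T_c\<close>, and it is the conditional law of \<open>R1\<close> given \<open>X1 = x\<close> after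
  centring at its mean, which is also the centre of the ellipsoid.\<close>

theorem proposition4p4:
  fixes M :: "'a measure"
    and X1 :: "'a \<Rightarrow> real^'k" and Y1 R1 :: "'a \<Rightarrow> real^'l"
    and fhat :: "real^'k \<Rightarrow> real^'l"
    and m :: "real^('k + 'l)" and \<Sigma> :: "real^('k::finite + 'l::finite)^('k + 'l)"
    and \<alpha> :: real
  assumes "prob_space M"
    and "X1 \<in> borel_measurable M" and "Y1 \<in> borel_measurable M"
    and "fhat \<in> borel_measurable borel"
    and R1_def: "R1 = (\<lambda>\<omega>. Y1 \<omega> - fhat (X1 \<omega>))"
    and "0 < \<alpha>" and "\<alpha> < 1"
    and "transpose \<Sigma> = \<Sigma>"
    and "min_eigenvalue \<Sigma> > 0"
    and "distr M borel (\<lambda>\<omega>. stack (X1 \<omega>) (R1 \<omega>)) = multivariate_normal m \<Sigma>"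
  shows "regular_conditional_distribution M X1 R1 (gaussian_conditional M X1 R1 \<Sigma>)
    \<and> (\<forall>x. measure (gaussian_conditional M X1 R1 \<Sigma> x) (F_inf M X1 R1 \<Sigma> \<alpha> x)
              = measure M {\<omega> \<in> space M. Y1 \<omega> - fhat (X1 \<omega>) \<in> F_inf M X1 R1 \<Sigma> \<alpha> (X1 \<omega>)})
    \<and> measure M {\<omega> \<in> space M. Y1 \<omega> - fhat (X1 \<omega>) \<in> F_inf M X1 R1 \<Sigma> \<alpha> (X1 \<omega>)} = 1 - \<alpha>"
proof -
  interpret prob_space M by fact
  note [measurable] = \<open>X1 \<in> borel_measurable M\<close> \<open>Y1 \<in> borel_measurable M\<close> \<open>fhat \<in> borel_measurable borel\<close>
  have R1 [measurable]: "R1 \<in> borel_measurable M" unfolding R1_def by measurable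
  note law = \<open>distr M borel (\<lambda>\<omega>. stack (X1 \<omega>) (R1 \<omega>)) = multivariate_normal m \<Sigma>\<close>
  have pd: "positive_definite \<Sigma>"
    using \<open>transpose \<Sigma> = \<Sigma>\<close> \<open>min_eigenvalue \<Sigma> > 0\<close> by (rule positive_definite_if_min_eigenvalue_pos)
  define A where "A = A_inf \<Sigma>"
  define \<mu> where "\<mu> = regression_mean m \<Sigma>"
  have pdA: "positive_definite A" unfolding A_def by (rule positive_definite_A_inf[OF pd])
  have [measurable]: "\<mu> \<in> borel_measurable borel" unfolding \<mu>_def by measurable
  let ?V = "\<lambda>\<omega>. stack (X1 \<omega>) (R1 \<omega>)"
  let ?K = "gaussian_conditional M X1 R1 \<Sigma>"
  let ?T = "T_c M X1 R1 \<Sigma>"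
  let ?F = "F_inf M X1 R1 \<Sigma> \<alpha>"

  have V_int: "integrable M ?V"
    using integrable_multivariate_normal[OF pd, of m] unfolding law[symmetric]
    by (simp add: integrable_distr_eq)
  have V_mean: "(\<integral>\<omega>. ?V \<omega> \<partial>M) = m"
    using integral_multivariate_normal[OF pd, of m] unfolding law[symmetric]
    by (simp add: integral_distr)
  have X_mean: "(\<integral>\<omega>. X1 \<omega> \<partial>M) = upper_part m" and R_mean: "(\<integral>\<omega>. R1 \<omega> \<partial>M) = lower_part m"
    using integral_bounded_linear[OF bounded_linear_parts(1) V_int]
      integral_bounded_linear[OF bounded_linear_parts(2) V_int] by (simp_all add: V_mean)
  have K_eq: "?K x = multivariate_normal (\<mu> x) A" for x
    by (simp add: gaussian_conditional_def X_mean R_mean \<mu>_def regression_mean_def regression_matrix_def A_def A_inf_def)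
  have T_eq: "?T \<omega> = R1 \<omega> - \<mu> (X1 \<omega>)" for \<omega>
    by (simp add: T_c_def X_mean R_mean \<mu>_def regression_mean_def)
  define \<xi> where "\<xi> z = z \<bullet> (matrix_inv A *v z)" for z :: "real^'l"
  have [measurable]: "\<xi> \<in> borel_measurable borel" unfolding \<xi>_def by measurable
  define q where "q = q_F M X1 R1 \<Sigma> \<alpha>"
  have F_iff: "z \<in> ?F x \<longleftrightarrow> \<xi> (z - \<mu> x) \<le> q" for z x
    by (simp add: F_inf_def Z0_inf_def X_mean R_mean \<mu>_def regression_mean_def \<xi>_def A_def q_def add.commute)

  have joint: "(\<integral>\<^sup>+\<omega>. h (?V \<omega>) \<partial>M) = (\<integral>\<^sup>+x. (\<integral>\<^sup>+y. h (stack x y) \<partial>?K x) \<partial>distr M borel X1)"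
    if [measurable]: "h \<in> borel_measurable borel" for h
  proof -
    have "distr (multivariate_normal m \<Sigma>) borel upper_part = distr M borel X1"
      unfolding law[symmetric] by (subst distr_distr) (auto simp: comp_def)
    then show ?thesis
      using multivariate_normal_disintegration[OF pd that, of m]
      by (simp add: K_eq nn_integral_distr \<mu>_def A_def flip: law)
  qed
  interpret N: prob_space "multivariate_normal 0 A" by (rule prob_space_multivariate_normal[OF pdA])
  interpret PX: prob_space "distr M borel X1" by (rule prob_space_distr) measurable

  have K_shift: "emeasure (?K x) {y. y - \<mu> x \<in> E} = emeasure (multivariate_normal 0 A) E"
    if [measurable]: "E \<in> sets borel" for x E
  proof -
    have "emeasure (?K x) {y. y - \<mu> x \<in> E}
        = emeasure (multivariate_normal 0 A) ((\<lambda>z. z + \<mu> x) -` {y. y - \<mu> x \<in> E} \<inter> space (multivariate_normal 0 A))"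
      unfolding K_eq by (subst multivariate_normal_eq_distr_translate) (rule emeasure_distr; measurable)
    then show ?thesis by simp
  qed
  have T_law: "emeasure M {\<omega> \<in> space M. ?T \<omega> \<in> E} = emeasure (multivariate_normal 0 A) E"
    if [measurable]: "E \<in> sets borel" for E
  proof -
    have "emeasure M {\<omega> \<in> space M. ?T \<omega> \<in> E}
        = (\<integral>\<^sup>+\<omega>. indicator {\<omega> \<in> space M. ?T \<omega> \<in> E} \<omega> \<partial>M)"
      by (rule nn_integral_indicator[symmetric]) (unfold T_eq, measurable)
    also have "\<dots> = (\<integral>\<^sup>+\<omega>. indicator {v. lower_part v - \<mu> (upper_part v) \<in> E} (?V \<omega>) \<partial>M)"
      by (intro nn_integral_cong) (simp add: T_eq indicator_def)
    also have "\<dots> = (\<integral>\<^sup>+x. (\<integral>\<^sup>+y. indicator {y. y - \<mu> x \<in> E} y \<partial>?K x) \<partial>distr M borel X1)"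
      by (subst joint) (auto intro!: nn_integral_cong simp: indicator_def)
    also have "\<dots> = (\<integral>\<^sup>+x. emeasure (multivariate_normal 0 A) E \<partial>distr M borel X1)"
      by (intro nn_integral_cong, subst nn_integral_indicator) (simp_all add: K_shift, simp add: K_eq)
    also have "\<dots> = emeasure (multivariate_normal 0 A) E"
      using PX.emeasure_space_1 by simp
    finally show ?thesis .
  qed

  have T_meas [measurable]: "?T \<in> borel_measurable M" unfolding T_eq by measurable
  have quantile: "measure M {\<omega> \<in> space M. \<xi> (?T \<omega>) \<le> q} = 1 - \<alpha>"
  proof -
    have q: "q = upper_quantile M \<alpha> (\<lambda>\<omega>. \<xi> (?T \<omega>))"
      by (simp add: q_def q_F_def \<xi>_def A_def)
    have "measure M {\<omega> \<in> space M. \<xi> (?T \<omega>) = r} = 0" for r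
    proof -
      have [measurable]: "{z. \<xi> z = r} \<in> sets borel" by measurable
      have "measure M {\<omega> \<in> space M. \<xi> (?T \<omega>) = r} = measure (multivariate_normal 0 A) {z. \<xi> z = r}"
        using T_law[of "{z. \<xi> z = r}"] by (simp add: measure_def)
      then show ?thesis
        by (simp add: \<xi>_def multivariate_normal_level_set positive_definite_matrix_inv pdA)
    qed
    then show ?thesis
      unfolding q using \<open>0 < \<alpha>\<close> \<open>\<alpha> < 1\<close> prob_space_axioms by (intro measure_le_upper_quantile) auto
  qed
  have E [measurable]: "{z. \<xi> z \<le> q} \<in> sets borel" by measurable
  have cond: "measure (?K x) (?F x) = measure (multivariate_normal 0 A) {z. \<xi> z \<le> q}" for x
  proof -
    have "?F x = {y. y - \<mu> x \<in> {z. \<xi> z \<le> q}}" by (auto simp: F_iff)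
    then show ?thesis using K_shift[OF E, of x] by (simp add: measure_def)
  qed
  have "measure M {\<omega> \<in> space M. Y1 \<omega> - fhat (X1 \<omega>) \<in> ?F (X1 \<omega>)} = measure M {\<omega> \<in> space M. \<xi> (?T \<omega>) \<le> q}"
    by (simp only: R1_def[THEN fun_cong, symmetric] F_iff T_eq)
  moreover have "measure M {\<omega> \<in> space M. \<xi> (?T \<omega>) \<le> q} = measure (multivariate_normal 0 A) {z. \<xi> z \<le> q}"
    using T_law[OF E] by (simp add: measure_def)
  moreover have "regular_conditional_distribution M X1 R1 ?K"
    unfolding regular_conditional_distribution_def
  proof (intro conjI ballI)
    show "?K \<in> borel \<rightarrow>\<^sub>M prob_algebra borel"
      unfolding K_eq[abs_def] by (rule multivariate_normal_kernel[OF pdA]) measurable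
    fix B :: "(real^'k) set" and C :: "(real^'l) set"
    assume [measurable]: "B \<in> sets borel" "C \<in> sets borel"
    have "emeasure M {\<omega> \<in> space M. X1 \<omega> \<in> B \<and> R1 \<omega> \<in> C}
        = (\<integral>\<^sup>+\<omega>. indicator {\<omega> \<in> space M. X1 \<omega> \<in> B \<and> R1 \<omega> \<in> C} \<omega> \<partial>M)"
      by (rule nn_integral_indicator[symmetric]) measurable
    also have "\<dots> = (\<integral>\<^sup>+\<omega>. indicator {v. upper_part v \<in> B \<and> lower_part v \<in> C} (?V \<omega>) \<partial>M)"
      by (intro nn_integral_cong) (simp add: indicator_def)
    also have "\<dots> = (\<integral>\<^sup>+x. (\<integral>\<^sup>+y. indicator B x * indicator C y \<partial>?K x) \<partial>distr M borel X1)"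
      by (subst joint) (auto intro!: nn_integral_cong simp: indicator_def)
    also have "\<dots> = (\<integral>\<^sup>+x\<in>B. emeasure (?K x) C \<partial>distr M borel X1)"
      by (intro nn_integral_cong, subst nn_integral_cmult_indicator) (simp_all add: K_eq mult.commute)
    finally show "emeasure M {\<omega> \<in> space M. X1 \<omega> \<in> B \<and> R1 \<omega> \<in> C}
        = (\<integral>\<^sup>+x\<in>B. emeasure (?K x) C \<partial>distr M borel X1)" .
  qed
  ultimately show ?thesis using cond quantile by simp
qed

end
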